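(* Let $M,N\ge 0$ be integers, let $L=\langle a_1,\dots,a_M,b_1,\dots,b_N\mid b_1^2,\dots,b_N^2\rangle$ with generating set $X=\{a_1^{\pm1},\dots,a_M^{\pm1},b_1,\dots,b_N\}$ (so that the Cayley graph $\mathrm{Cay}(L,X)$ is a tree), and let $G$ be a group with finite symmetric generating set $Y$. If $L$ is infinite, then the radius of convergence of the conjugacy growth series $\tilde\sigma_{(G\wr L,\vec Y)}(z)$ is the same as the radius of convergence of the standard growth series $\sigma_{(G\wr L,\vec Y)}(z)$.
   Context: Wreath product. $e,e'$ are the neutral elements of $G,L$. $G\wr L=\bigl(\bigoplus_{i\in L}G\bigr)\rtimes L$ with product $(\eta,m)(\theta,n)=(\eta\theta^m,mn)$, where $\theta^m(i)=\theta(m^{-1}i)$. For $g\in G$, $\vec g\in\bigoplus_{i\in L}G$ has value $g$ at $e'$ and $e$ elsewhere. The generating set is $\vec Y=\{(\vec e,x):x\in X\}\cup\{(\vec y,e'):y\in Y\}$. Growth series. For a group $H$ with finite symmetric generating set $Z$, $|h|_Z$ is the word length. The standard growth series is $\sigma_{(H,Z)}(z)=\sum_{n\ge0}\#\{h\in H:|h|_Z=n\}z^n$. The length of a conjugacy class is the minimum of $|h|_Z$ over its elements $h$; the conjugacy growth series $\tilde\sigma_{(H,Z)}(z)$ has as coefficient of $z^n$ the number of conjugacy classes of $H$ of length $n$. *)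

theory Defs
  imports "HOL-Algebra.Algebra" "HOL-Analysis.Analysis"
begin

section \<open>Groups given by generators and relators\<close>

text \<open>A letter \<open>(s, True)\<close> stands for the generator \<open>s\<close> and \<open>(s, False)\<close> for its inverse.\<close>

type_synonym 's word = "('s \<times> bool) list"

definition words :: "'s set \<Rightarrow> 's word set" where
  "words S = lists (S \<times> UNIV)"

text \<open>The congruence on words generated by \<open>s s\<inverse> = s\<inverse> s = 1\<close> and \<open>r = 1\<close> for all relators \<open>r\<close>.\<close>

inductive_set pres_rel :: "'s set \<Rightarrow> 's word set \<Rightarrow> ('s word \<times> 's word) set"
  for S :: "'s set" and R :: "'s word set" where
  refl: "u \<in> words S \<Longrightarrow> (u, u) \<in> pres_rel S R"
| sym: "(u, v) \<in> pres_rel S R \<Longrightarrow> (v, u) \<in> pres_rel S R"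
| trans: "(u, v) \<in> pres_rel S R \<Longrightarrow> (v, w) \<in> pres_rel S R \<Longrightarrow> (u, w) \<in> pres_rel S R"
| cancel: "u \<in> words S \<Longrightarrow> v \<in> words S \<Longrightarrow> s \<in> S \<Longrightarrow>
    (u @ [(s, b), (s, \<not> b)] @ v, u @ v) \<in> pres_rel S R"
| relator: "u \<in> words S \<Longrightarrow> v \<in> words S \<Longrightarrow> r \<in> R \<Longrightarrow> r \<in> words S \<Longrightarrow>
    (u @ r @ v, u @ v) \<in> pres_rel S R"

definition word_class :: "'s set \<Rightarrow> 's word set \<Rightarrow> 's word \<Rightarrow> 's word set" where
  "word_class S R w = pres_rel S R `` {w}"

definition presented_group :: "'s set \<Rightarrow> 's word set \<Rightarrow> 's word set monoid" where
  "presented_group S R =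
    \<lparr>carrier = words S // pres_rel S R,
     monoid.mult = (\<lambda>A B. \<Union>a\<in>A. \<Union>b\<in>B. word_class S R (a @ b)),
     one = word_class S R []\<rparr>"

section \<open>The group with generators \<open>a\<^sub>i\<close>, \<open>b\<^sub>j\<close> and relators \<open>b\<^sub>j\<^sup>2\<close>\<close>

datatype tree_gen = GenA nat | GenB nat

definition tree_gens :: "nat \<Rightarrow> nat \<Rightarrow> tree_gen set" where
  "tree_gens M N = GenA ` {..<M} \<union> GenB ` {..<N}"

definition tree_relators :: "nat \<Rightarrow> tree_gen word set" where
  "tree_relators N = {[(GenB j, True), (GenB j, True)] | j. j < N}"

definition tree_group :: "nat \<Rightarrow> nat \<Rightarrow> tree_gen word set monoid" where
  "tree_group M N = presented_group (tree_gens M N) (tree_relators N)"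

definition tree_elt :: "nat \<Rightarrow> nat \<Rightarrow> tree_gen \<Rightarrow> tree_gen word set" where
  "tree_elt M N s = word_class (tree_gens M N) (tree_relators N) [(s, True)]"

definition tree_genset :: "nat \<Rightarrow> nat \<Rightarrow> tree_gen word set set" where
  "tree_genset M N =
    (\<Union>i<M. {tree_elt M N (GenA i), inv\<^bsub>tree_group M N\<^esub> tree_elt M N (GenA i)}) \<union>
    (\<Union>j<N. {tree_elt M N (GenB j)})"

section \<open>Wreath products\<close>

text \<open>The direct sum \<open>sum_group\<close> consists of finitely supported functions on the carrier of \<open>L\<close>,
  extended by \<open>undefined\<close> outside it; hence the restricted abstractions below.\<close>

definition wreath_shift ::
    "('l, 'm) monoid_scheme \<Rightarrow> 'l \<Rightarrow> ('l \<Rightarrow> 'g) \<Rightarrow> 'l \<Rightarrow> 'g" where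
  "wreath_shift L m \<theta> = (\<lambda>i\<in>carrier L. \<theta> (inv\<^bsub>L\<^esub> m \<otimes>\<^bsub>L\<^esub> i))"

definition wreath_product ::
    "('g, 'n) monoid_scheme \<Rightarrow> ('l, 'm) monoid_scheme \<Rightarrow> (('l \<Rightarrow> 'g) \<times> 'l) monoid" where
  "wreath_product G L =
    \<lparr>carrier = carrier (sum_group (carrier L) (\<lambda>_. G)) \<times> carrier L,
     monoid.mult = (\<lambda>(\<eta>, m) (\<theta>, n).
       (\<eta> \<otimes>\<^bsub>sum_group (carrier L) (\<lambda>_. G)\<^esub> wreath_shift L m \<theta>, m \<otimes>\<^bsub>L\<^esub> n)),
     one = (\<one>\<^bsub>sum_group (carrier L) (\<lambda>_. G)\<^esub>, \<one>\<^bsub>L\<^esub>)\<rparr>"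

definition wreath_vec ::
    "('g, 'n) monoid_scheme \<Rightarrow> ('l, 'm) monoid_scheme \<Rightarrow> 'g \<Rightarrow> 'l \<Rightarrow> 'g" where
  "wreath_vec G L g = (\<lambda>i\<in>carrier L. if i = \<one>\<^bsub>L\<^esub> then g else \<one>\<^bsub>G\<^esub>)"

definition wreath_gens ::
    "('g, 'n) monoid_scheme \<Rightarrow> ('l, 'm) monoid_scheme \<Rightarrow> 'g set \<Rightarrow> 'l set \<Rightarrow> (('l \<Rightarrow> 'g) \<times> 'l) set" where
  "wreath_gens G L Y Z =
    {(wreath_vec G L \<one>\<^bsub>G\<^esub>, z) | z. z \<in> Z} \<union> {(wreath_vec G L y, \<one>\<^bsub>L\<^esub>) | y. y \<in> Y}"

section \<open>Growth series\<close>

definition finite_symmetric_generating_set :: "('h, 'n) monoid_scheme \<Rightarrow> 'h set \<Rightarrow> bool" where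
  "finite_symmetric_generating_set H Z \<longleftrightarrow>
    finite Z \<and> Z \<subseteq> carrier H \<and> (\<forall>z\<in>Z. inv\<^bsub>H\<^esub> z \<in> Z) \<and> generate H Z = carrier H"

definition word_length :: "('h, 'n) monoid_scheme \<Rightarrow> 'h set \<Rightarrow> 'h \<Rightarrow> nat" where
  "word_length H Z h =
    (LEAST n. \<exists>zs. set zs \<subseteq> Z \<and> length zs = n \<and> foldr (\<otimes>\<^bsub>H\<^esub>) zs \<one>\<^bsub>H\<^esub> = h)"

definition growth_series :: "('h, 'n) monoid_scheme \<Rightarrow> 'h set \<Rightarrow> complex fps" where
  "growth_series H Z = Abs_fps (\<lambda>n. of_nat (card {h \<in> carrier H. word_length H Z h = n}))"

definition conjugacy_class :: "('h, 'n) monoid_scheme \<Rightarrow> 'h \<Rightarrow> 'h set" where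
  "conjugacy_class H h = {x \<otimes>\<^bsub>H\<^esub> h \<otimes>\<^bsub>H\<^esub> inv\<^bsub>H\<^esub> x | x. x \<in> carrier H}"

definition conjugacy_classes :: "('h, 'n) monoid_scheme \<Rightarrow> 'h set set" where
  "conjugacy_classes H = conjugacy_class H ` carrier H"

definition class_length :: "('h, 'n) monoid_scheme \<Rightarrow> 'h set \<Rightarrow> 'h set \<Rightarrow> nat" where
  "class_length H Z C = (INF h\<in>C. word_length H Z h)"

definition conjugacy_growth_series :: "('h, 'n) monoid_scheme \<Rightarrow> 'h set \<Rightarrow> complex fps" where
  "conjugacy_growth_series H Z =
    Abs_fps (\<lambda>n. of_nat (card {C \<in> conjugacy_classes H. class_length H Z C = n}))"

end

theory Submission
  imports Defs
begin

text \<open>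
  A class of length \<open>n\<close> contains an element of length \<open>n\<close>, so the coefficients of the conjugacy growth
  series are at most those of the standard one. Conversely, every element of length \<open>n\<close> is turned
  into a conjugacy class of length at most \<open>n + 2\<close>, in such a way that the number of elements that
  yield the same class is bounded by a polynomial in \<open>n\<close>. As there are infinitely many classes, the
  radius of convergence does not notice polynomial factors, the passage to partial sums and a shift
  by \<open>2\<close> (\<open>conv_radius_eq_of_polynomial_comparison\<close>).

  The length of \<open>(\<eta>, x)\<close> is the length of a shortest walk in the tree from \<open>\<one>\<close> to \<open>x\<close> that visits all
  vertices where \<open>\<eta>\<close> is nontrivial, plus the lengths of the values of \<open>\<eta>\<close> (\<open>ex_shortest_walk\<close>,
  \<open>word_length_le_walk\<close>). If the walk leaves \<open>\<one>\<close> along an edge that does not lead towards \<open>x\<close>, it has to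
  come back through the same edge, and cutting the walk there and reassembling the pieces yields a
  shorter walk that visits the same vertices but starts at the other end of the edge (\<open>rotate_walk\<close>).
  Iterating this at both ends leads to a walk whose ends are leaves of the tree \<open>T\<close> that it visits
  (\<open>walk_between_leaves\<close>), and the geodesic between the new ends contains the old ones. After a
  translation the new walk goes from \<open>\<one>\<close> to some \<open>v\<close>. Since \<open>L\<close> is infinite, at most two more letters
  make \<open>v\<close> a nontrivial cyclically reduced element \<open>m\<close> (\<open>ex_cyclic_extension\<close>), and, as the ends of
  \<open>T\<close> are leaves, \<open>T\<close> then meets every orbit of \<open>\<langle>m\<rangle>\<close> at most once
  (\<open>leaf_tree_subset_fundamental_domain\<close>).

  So it suffices to count elements \<open>(\<eta>, m)\<close> with \<open>m\<close> cyclically reduced and \<open>\<eta>\<close> supported in a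
  fundamental domain for \<open>\<langle>m\<rangle>\<close>; they form the set \<open>spread_out\<close>. Along an orbit of \<open>\<langle>m\<rangle>\<close>, which is
  infinite, the ordered product of the values of \<open>\<eta>\<close> does not change under conjugation by a finitely
  supported function, and here that product is the only nontrivial value on the orbit. Hence
  two such elements that are conjugate by a function agree (\<open>spread_out_rigid\<close>), and the
  \<open>L\<close>-component of a shortest conjugator is a prefix of \<open>m\<close> or of \<open>m\<inverse>\<close> (\<open>nf_conjugator\<close>). A class
  therefore contains at most \<open>2 (\<bar>m\<bar> + 1)\<close> elements of this form. Finally \<open>(\<eta>, m)\<close> together with the
  positions of the original ends on the word \<open>m\<close> determines the original element, which gives the
  bound \<open>card_sphere_le\<close>.

  The one fact about \<open>L\<close> behind all this is that nonempty reduced words are nontrivial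
  (\<open>tree_like_tree_group\<close>); it is obtained by letting the letters act on reduced words.
\<close>

section \<open>Words in a group and the elements they visit\<close>

definition word_val :: "('h, 'n) monoid_scheme \<Rightarrow> 'h list \<Rightarrow> 'h" where
  "word_val H w = foldr (\<otimes>\<^bsub>H\<^esub>) w \<one>\<^bsub>H\<^esub>"

lemma word_val_simps [simp]:
  "word_val H [] = \<one>\<^bsub>H\<^esub>"
  "word_val H (a # w) = a \<otimes>\<^bsub>H\<^esub> word_val H w"
  by (simp_all add: word_val_def)

context group
begin

lemma word_val_closed [simp]: "set w \<subseteq> carrier G \<Longrightarrow> word_val G w \<in> carrier G"
  by (induction w) auto

lemma inv_cancel_left:
  "a \<in> carrier G \<Longrightarrow> b \<in> carrier G \<Longrightarrow> inv a \<otimes> (a \<otimes> b) = b"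
  "a \<in> carrier G \<Longrightarrow> b \<in> carrier G \<Longrightarrow> a \<otimes> (inv a \<otimes> b) = b"
  by (simp_all flip: m_assoc)

lemma inj_on_translation: "a \<in> carrier G \<Longrightarrow> S \<subseteq> carrier G \<Longrightarrow> inj_on ((\<otimes>) a) S"
  by (rule inj_onI) (meson l_cancel subsetD)

lemma word_val_append:
  "set u \<subseteq> carrier G \<Longrightarrow> set v \<subseteq> carrier G \<Longrightarrow> word_val G (u @ v) = word_val G u \<otimes> word_val G v"
  by (induction u) (auto simp: m_assoc)

definition word_inv :: "'a list \<Rightarrow> 'a list" where
  "word_inv w = rev (map (m_inv G) w)"

lemma word_inv_simps [simp]:
  "word_inv [] = []" "word_inv (a # w) = word_inv w @ [inv a]"
  "word_inv (u @ v) = word_inv v @ word_inv u" "length (word_inv w) = length w"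
  "word_inv w = [] \<longleftrightarrow> w = []"
  by (simp_all add: word_inv_def)

lemma hd_word_inv: "w \<noteq> [] \<Longrightarrow> hd (word_inv w) = inv (last w)"
  by (simp add: word_inv_def hd_rev last_map)

lemma last_word_inv: "w \<noteq> [] \<Longrightarrow> last (word_inv w) = inv (hd w)"
  by (simp add: word_inv_def last_rev hd_map)

lemma set_word_inv: "set w \<subseteq> carrier G \<Longrightarrow> set (word_inv w) \<subseteq> carrier G"
  by (auto simp: word_inv_def)

lemma word_inv_word_inv: "set w \<subseteq> carrier G \<Longrightarrow> word_inv (word_inv w) = w"
  by (induction w) auto

lemma word_val_word_inv: "set w \<subseteq> carrier G \<Longrightarrow> word_val G (word_inv w) = inv (word_val G w)"
  by (induction w) (auto simp: word_val_append set_word_inv inv_mult_group)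

definition reduced_word :: "'a list \<Rightarrow> bool" where
  "reduced_word w \<longleftrightarrow> successively (\<lambda>a b. b \<noteq> inv a) w"

lemma reduced_word_Nil [simp]: "reduced_word []"
  and reduced_word_Cons:
    "reduced_word (a # w) \<longleftrightarrow> reduced_word w \<and> (w \<noteq> [] \<longrightarrow> hd w \<noteq> inv a)"
  and reduced_word_append:
    "reduced_word (u @ v) \<longleftrightarrow> reduced_word u \<and> reduced_word v \<and>
      (u \<noteq> [] \<longrightarrow> v \<noteq> [] \<longrightarrow> hd v \<noteq> inv (last u))"
  by (auto simp: reduced_word_def successively_append_iff successively_Cons)

lemma reduced_word_inv:
  "set w \<subseteq> carrier G \<Longrightarrow> reduced_word w \<Longrightarrow> reduced_word (word_inv w)"
proof (induction w)
  case (Cons a w)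
  then show ?case
    by (cases w) (auto simp: reduced_word_Cons reduced_word_append last_word_inv)
qed simp

text \<open>The vertices of the walk in the Cayley graph that starts at \<open>\<one>\<close> and reads the word.\<close>

primrec trail :: "'a list \<Rightarrow> 'a set" where
  "trail [] = {\<one>}"
| "trail (a # w) = insert \<one> ((\<otimes>) a ` trail w)"

lemma one_in_trail [simp]: "\<one> \<in> trail w"
  by (cases w) auto

lemma finite_trail [simp]: "finite (trail w)"
  by (induction w) auto

lemma trail_closed: "set w \<subseteq> carrier G \<Longrightarrow> trail w \<subseteq> carrier G"
  by (induction w) (auto simp: image_subset_iff)

lemma image_mult_mult:
  "a \<in> carrier G \<Longrightarrow> b \<in> carrier G \<Longrightarrow> S \<subseteq> carrier G \<Longrightarrow>
    (\<otimes>) (a \<otimes> b) ` S = (\<otimes>) a ` (\<otimes>) b ` S"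
  by (force simp: image_image m_assoc intro!: image_cong)

lemma image_mult_one: "S \<subseteq> carrier G \<Longrightarrow> (\<otimes>) \<one> ` S = S"
  by (force simp: image_iff)

lemma trail_append:
  "set u \<subseteq> carrier G \<Longrightarrow> set v \<subseteq> carrier G \<Longrightarrow>
    trail (u @ v) = trail u \<union> (\<otimes>) (word_val G u) ` trail v"
  by (induction u) (auto simp: image_mult_one trail_closed image_mult_mult image_Un)

lemma trail_append_loop:
  "set u \<subseteq> carrier G \<Longrightarrow> set v \<subseteq> carrier G \<Longrightarrow> word_val G u = \<one> \<Longrightarrow>
    trail (u @ v) = trail u \<union> trail v"
  by (simp add: trail_append image_mult_one trail_closed)

lemma hd_last_closed:
  "set w \<subseteq> carrier G \<Longrightarrow> w \<noteq> [] \<Longrightarrow> hd w \<in> carrier G \<and> last w \<in> carrier G"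
  by auto

lemma word_val_in_trail: "set w \<subseteq> carrier G \<Longrightarrow> word_val G w \<in> trail w"
  by (induction w) auto

lemma trail_word_inv:
  "set w \<subseteq> carrier G \<Longrightarrow> trail (word_inv w) = (\<otimes>) (inv (word_val G w)) ` trail w"
proof (induction w)
  case (Cons a w)
  let ?i = "inv (word_val G w)"
  from Cons.prems have c: "a \<in> carrier G" "set w \<subseteq> carrier G" by auto
  have "trail (word_inv (a # w)) = (\<otimes>) ?i ` trail w \<union> (\<otimes>) ?i ` {\<one>, inv a}"
    using Cons c by (simp add: trail_append set_word_inv word_val_word_inv)
  also have "\<dots> = (\<otimes>) ?i ` insert (inv a) (trail w)"
    using one_in_trail[of w] by blast
  also have "insert (inv a) (trail w) = (\<otimes>) (inv a) ` trail (a # w)"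
    using c trail_closed[of w] by (simp flip: image_mult_mult add: image_mult_one)
  finally show ?case
    using c trail_closed[of "a # w"] by (simp flip: image_mult_mult add: inv_mult_group)
qed auto

end

section \<open>Groups in which reduced words are normal forms\<close>

text \<open>The last assumption says that the Cayley graph with respect to \<open>Z\<close> is a tree. Involutions in \<open>Z\<close> are
  their own inverses, so \<open>[b, b]\<close> is not reduced for them.\<close>

locale tree_like_group = group L for L (structure) +
  fixes Z
  assumes Z_closed: "Z \<subseteq> carrier L"
    and Z_inv: "x \<in> Z \<Longrightarrow> inv x \<in> Z"
    and finite_Z: "finite Z"
    and Z_generates: "generate L Z = carrier L"
    and reduced_nontrivial:
      "set w \<subseteq> Z \<Longrightarrow> reduced_word w \<Longrightarrow> word_val L w = \<one> \<Longrightarrow> w = []"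
begin

definition normal_words :: "'a list set" where
  "normal_words = {w. set w \<subseteq> Z \<and> reduced_word w}"

definition nf :: "'a \<Rightarrow> 'a list" where
  "nf g = (THE w. w \<in> normal_words \<and> word_val L w = g)"

lemma Z_word_closed: "set w \<subseteq> Z \<Longrightarrow> set w \<subseteq> carrier L"
  using Z_closed by auto

lemma Z_word_inv: "set w \<subseteq> Z \<Longrightarrow> set (word_inv w) \<subseteq> Z"
  using Z_inv by (auto simp: word_inv_def)

lemma inv_Z_eq_iff: "a \<in> Z \<Longrightarrow> b \<in> Z \<Longrightarrow> inv a = b \<longleftrightarrow> a = inv b"
  using Z_closed by auto

lemma normal_words_inv: "w \<in> normal_words \<Longrightarrow> word_inv w \<in> normal_words"
  by (auto simp: normal_words_def reduced_word_inv Z_word_closed dest: Z_word_inv)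

lemma normal_words_closed: "w \<in> normal_words \<Longrightarrow> set w \<subseteq> carrier L"
  by (auto simp: normal_words_def dest: Z_word_closed)

lemma normal_words_Nil [simp]: "[] \<in> normal_words"
  by (simp add: normal_words_def)

lemma normal_words_Cons:
  "a # w \<in> normal_words \<longleftrightarrow> a \<in> Z \<and> w \<in> normal_words \<and> (w \<noteq> [] \<longrightarrow> hd w \<noteq> inv a)"
  by (auto simp: normal_words_def reduced_word_Cons)

lemma normal_words_append:
  "u @ v \<in> normal_words \<longleftrightarrow> u \<in> normal_words \<and> v \<in> normal_words \<and>
      (u \<noteq> [] \<longrightarrow> v \<noteq> [] \<longrightarrow> hd v \<noteq> inv (last u))"
  by (auto simp: normal_words_def reduced_word_append)

text \<open>After a common prefix is cancelled, \<open>u\<inverse> v\<close> is reduced.\<close>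

lemma normal_word_unique:
  assumes "u \<in> normal_words" "v \<in> normal_words" "word_val L u = word_val L v"
  shows "u = v"
  using assms
proof (induction u arbitrary: v)
  case Nil
  then show ?case using reduced_nontrivial[of v] by (auto simp: normal_words_def)
next
  case (Cons a u)
  show ?case
  proof (cases "v \<noteq> [] \<and> hd v = a")
    case True
    then obtain v' where v: "v = a # v'" by (cases v) auto
    have "set u \<subseteq> carrier L" "set v' \<subseteq> carrier L" "a \<in> carrier L"
      using Cons.prems v normal_words_closed by fastforce+
    then have "word_val L u = word_val L v'"
      using Cons.prems(3) v by simp
    then show ?thesis using Cons v by (auto simp: normal_words_Cons)
  next
    case False
    have cl: "set (a # u) \<subseteq> carrier L" "set v \<subseteq> carrier L"
      using Cons.prems normal_words_closed by blast+
    have "word_inv (a # u) @ v \<in> normal_words"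
      using Cons.prems(2) False normal_words_inv[OF Cons.prems(1)] cl
        normal_words_append[of "word_inv (a # u)" v] last_word_inv[of "a # u"]
      by (auto simp del: append_assoc)
    moreover have "word_val L (word_inv (a # u) @ v) = \<one>"
      using cl Cons.prems(3) set_word_inv[OF cl(1)]
      by (metis l_inv word_val_append word_val_closed word_val_word_inv)
    ultimately show ?thesis
      using reduced_nontrivial[of "word_inv (a # u) @ v"] by (simp add: normal_words_def)
  qed
qed

lemma ex_normal_word:
  assumes "g \<in> carrier L"
  shows "\<exists>w\<in>normal_words. word_val L w = g"
proof -
  have step: "\<exists>w'\<in>normal_words. word_val L w' = a \<otimes> word_val L w"
    if "a \<in> Z" "w \<in> normal_words" for a w
  proof (cases "w \<noteq> [] \<and> hd w = inv a")
    case True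
    then obtain w' where "w = inv a # w'" by (cases w) auto
    moreover from this have "set w' \<subseteq> carrier L" "a \<in> carrier L"
      using that normal_words_closed[of w] Z_closed by auto
    ultimately show ?thesis
      using that by (intro bexI[of _ w']) (auto simp: normal_words_Cons simp flip: m_assoc)
  qed (use that in \<open>auto intro!: bexI[of _ "a # w"] simp: normal_words_Cons\<close>)
  have app: "\<exists>w'\<in>normal_words. word_val L w' = word_val L u \<otimes> word_val L w"
    if "u \<in> normal_words" "w \<in> normal_words" for u w
    using that
  proof (induction u)
    case Nil
    then show ?case using normal_words_closed[of w] by auto
  next
    case (Cons a u)
    then obtain w' where w': "w' \<in> normal_words" "word_val L w' = word_val L u \<otimes> word_val L w"
      by (auto simp: normal_words_Cons)
    then show ?case
      using step[of a w'] Cons.prems normal_words_closed[of "a # u"] normal_words_closed[of w]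
      by (auto simp: normal_words_Cons m_assoc)
  qed
  have "g \<in> generate L Z" using assms Z_generates by simp
  then show ?thesis
  proof (induction rule: generate.induct)
    case one
    then show ?case by (intro bexI[of _ "[]"]) auto
  next
    case (incl h)
    then show ?case using Z_closed by (intro bexI[of _ "[h]"]) (auto simp: normal_words_Cons)
  next
    case (inv h)
    then show ?case
      using Z_closed Z_inv by (intro bexI[of _ "[inv h]"]) (auto simp: normal_words_Cons)
  next
    case (eng h1 h2)
    then show ?case using app by metis
  qed
qed

lemma nf_normal [simp]: "g \<in> carrier L \<Longrightarrow> nf g \<in> normal_words"
  and val_nf [simp]: "g \<in> carrier L \<Longrightarrow> word_val L (nf g) = g"
proof -
  assume g: "g \<in> carrier L"
  have "\<exists>!w. w \<in> normal_words \<and> word_val L w = g"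
    using ex_normal_word[OF g] normal_word_unique by metis
  from theI'[OF this] show "nf g \<in> normal_words" "word_val L (nf g) = g"
    by (simp_all add: nf_def)
qed

lemma nf_val: "w \<in> normal_words \<Longrightarrow> nf (word_val L w) = w"
  by (simp add: normal_word_unique normal_words_closed)

lemma nf_closed: "g \<in> carrier L \<Longrightarrow> set (nf g) \<subseteq> Z"
  using nf_normal[of g] by (simp add: normal_words_def)

lemma nf_letters_closed: "g \<in> carrier L \<Longrightarrow> set (nf g) \<subseteq> carrier L"
  using nf_closed Z_closed by blast

lemma nf_one [simp]: "nf \<one> = []"
  using nf_val[of "[]"] by simp

lemma nf_eq_Nil_iff: "g \<in> carrier L \<Longrightarrow> nf g = [] \<longleftrightarrow> g = \<one>"
  using val_nf[of g] nf_one by fastforce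

lemma nf_inject: "g \<in> carrier L \<Longrightarrow> h \<in> carrier L \<Longrightarrow> nf g = nf h \<longleftrightarrow> g = h"
  using val_nf by metis

lemma nf_inv: "g \<in> carrier L \<Longrightarrow> nf (inv g) = word_inv (nf g)"
  using nf_val[OF normal_words_inv[OF nf_normal]] word_val_word_inv[OF normal_words_closed[OF nf_normal]]
  by simp

lemma nf_mult:
  assumes "g \<in> carrier L" "h \<in> carrier L"
    and "nf g \<noteq> [] \<Longrightarrow> nf h \<noteq> [] \<Longrightarrow> hd (nf h) \<noteq> inv (last (nf g))"
  shows "nf (g \<otimes> h) = nf g @ nf h"
proof -
  have "nf g @ nf h \<in> normal_words" using assms by (auto simp: normal_words_append)
  then show ?thesis
    using nf_val[of "nf g @ nf h"] assms by (simp add: word_val_append normal_words_closed)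
qed

lemma nf_Z: "a \<in> Z \<Longrightarrow> nf a = [a]"
  using nf_val[of "[a]"] Z_closed by (auto simp: normal_words_Cons)

definition starts :: "'a \<Rightarrow> 'a \<Rightarrow> bool" where
  "starts s g \<longleftrightarrow> nf g \<noteq> [] \<and> hd (nf g) = s"

lemma not_starts_one [simp]: "\<not> starts s \<one>"
  by (simp add: starts_def)

lemma nf_letter_mult:
  assumes "g \<in> carrier L" "a \<in> Z" "\<not> starts (inv a) g"
  shows "nf (a \<otimes> g) = a # nf g"
  using assms nf_mult[of a g] Z_closed nf_Z[of a] by (auto simp: starts_def)

text \<open>The edge from \<open>\<one>\<close> to \<open>s\<close> is the only one that enters the cone of the elements whose
  normal form starts with \<open>s\<close>: right multiplication by a letter changes only the end of a normal form.\<close>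

lemma enter_cone:
  assumes "g \<in> carrier L" "a \<in> Z" "\<not> starts s g" "starts s (g \<otimes> a)"
  shows "g = \<one> \<and> a = s"
proof (cases "nf g = []")
  case True
  then show ?thesis using assms nf_eq_Nil_iff[of g] nf_Z[of a] Z_closed by (auto simp: starts_def)
next
  case False
  have a: "a \<in> carrier L" using assms Z_closed by auto
  show ?thesis
  proof (cases "last (nf g) = inv a")
    case True
    define u where "u = butlast (nf g)"
    have nfg: "nf g = u @ [inv a]" using False True by (metis append_butlast_last_id u_def)
    then have u: "u \<in> normal_words" using nf_normal[OF assms(1)] by (simp add: normal_words_append)
    then have "word_val L u \<otimes> inv a = g"
      using val_nf[OF assms(1)] nfg a by (simp add: word_val_append normal_words_closed)
    then have "g \<otimes> a = word_val L u" using a normal_words_closed[OF u] by (auto simp: m_assoc)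
    then have "nf (g \<otimes> a) = u" using nf_val u by simp
    then show ?thesis using assms nfg by (auto simp: starts_def)
  next
    case ne: False
    have "nf (g \<otimes> a) = nf g @ [a]"
      using nf_mult[of g a] assms a ne nf_Z[of a] nf_closed[OF assms(1)] False
      by (metis inv_Z_eq_iff last_in_set list.sel(1) subsetD)
    then show ?thesis using assms False by (auto simp: starts_def)
  qed
qed

lemma leave_cone:
  assumes "g \<in> carrier L" "a \<in> Z" "starts s g" "\<not> starts s (g \<otimes> a)"
  shows "g = s \<and> a = inv s"
proof -
  have a: "a \<in> carrier L" using assms Z_closed by auto
  have "g \<otimes> a = \<one> \<and> inv a = s"
    using enter_cone[of "g \<otimes> a" "inv a" s] assms a Z_inv by (auto simp: m_assoc)
  then show ?thesis using a assms(1) by (metis inv_equality inv_inv)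
qed

end

section \<open>Moving the ends of a walk in the tree to leaves\<close>

context tree_like_group
begin

text \<open>A walk from outside the cone of \<open>s\<close> that reaches the cone first stands at \<open>\<one>\<close> and then reads the
  letter \<open>s\<close>; the walk is taken to start at an arbitrary \<open>g\<close> to make the induction work.\<close>

lemma enter_split:
  assumes "set w \<subseteq> Z" "g \<in> carrier L" "\<not> starts s g" "y \<in> trail w" "starts s (g \<otimes> y)"
  shows "\<exists>u v. w = u @ s # v \<and> g \<otimes> word_val L u = \<one>"
  using assms
proof (induction w arbitrary: g y)
  case (Cons a w)
  then have a: "a \<in> carrier L" "a \<in> Z" using Z_closed by auto
  obtain y' where y': "y' \<in> trail w" "y = a \<otimes> y'" using Cons.prems by auto
  then have y'c: "y' \<in> carrier L" using trail_closed[OF Z_word_closed, of w] Cons.prems by auto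
  show ?case
  proof (cases "starts s (g \<otimes> a)")
    case True
    then have "g = \<one> \<and> a = s" using enter_cone Cons.prems a by blast
    then show ?thesis by (intro exI[of _ "[]"] exI[of _ w]) auto
  next
    case False
    obtain u v where uv: "w = u @ s # v" "g \<otimes> a \<otimes> word_val L u = \<one>"
      using Cons.IH[of "g \<otimes> a" y'] Cons.prems False a y' y'c by (auto simp: m_assoc)
    have "set u \<subseteq> carrier L" using uv Cons.prems Z_closed by auto
    then show ?thesis
      using uv a Cons.prems by (intro exI[of _ "a # u"] exI[of _ v]) (auto simp: m_assoc)
  qed
qed auto

lemma leave_split:
  assumes "set w \<subseteq> Z" "g \<in> carrier L" "starts s g" "\<not> starts s (g \<otimes> word_val L w)"
  shows "\<exists>u v. w = u @ inv s # v \<and> g \<otimes> word_val L u = s"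
  using assms
proof (induction w arbitrary: g)
  case (Cons a w)
  then have a: "a \<in> carrier L" "a \<in> Z" using Z_closed by auto
  have wc: "set w \<subseteq> carrier L" using Cons.prems Z_closed by auto
  show ?case
  proof (cases "starts s (g \<otimes> a)")
    case False
    then have "g = s \<and> a = inv s" using leave_cone Cons.prems a by blast
    then show ?thesis using Cons.prems by (intro exI[of _ "[]"] exI[of _ w]) auto
  next
    case True
    obtain u v where uv: "w = u @ inv s # v" "g \<otimes> a \<otimes> word_val L u = s"
      using Cons.IH[of "g \<otimes> a"] Cons.prems True a wc by (auto simp: m_assoc)
    have "set u \<subseteq> carrier L" using uv wc by auto
    then show ?thesis
      using uv a Cons.prems by (intro exI[of _ "a # u"] exI[of _ v]) (auto simp: m_assoc)
  qed
qed auto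

text \<open>The vertex \<open>y\<close> lies in the cone of \<open>s\<close>, the end of the walk does not, so the walk has the form
  \<open>u s v s\<inverse> x\<close> with loops \<open>u\<close> at \<open>\<one>\<close> and \<open>v\<close> at \<open>s\<close>. The walk \<open>v s\<inverse> u x\<close> started at \<open>s\<close> visits the same
  vertices and saves one step; it is moved to \<open>\<one>\<close> by \<open>s\<inverse>\<close>.\<close>

lemma rotate_walk:
  assumes "set w \<subseteq> Z" "y \<in> trail w" "starts s y" "\<not> starts s (word_val L w)" "s \<in> Z"
  shows "\<exists>w'. set w' \<subseteq> Z \<and> length w' < length w \<and> trail w' = (\<otimes>) (inv s) ` trail w \<and>
    word_val L w' = inv s \<otimes> word_val L w"
proof -
  have s: "s \<in> carrier L" "inv s \<in> Z" using assms Z_closed Z_inv by auto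
  have yc: "y \<in> carrier L" using assms trail_closed[OF Z_word_closed, of w] by auto
  obtain u v0 where w0: "w = u @ s # v0" and u1: "\<one> \<otimes> word_val L u = \<one>"
    using enter_split[of w "\<one>" s y] assms yc by auto
  have cl: "set u \<subseteq> carrier L" "set v0 \<subseteq> carrier L" "set u \<subseteq> Z" "set v0 \<subseteq> Z"
    using w0 assms Z_closed by auto
  then have u: "word_val L u = \<one>" using u1 by simp
  have st: "starts s s" using assms nf_Z by (auto simp: starts_def)
  have "\<not> starts s (s \<otimes> word_val L v0)"
    using assms(4) w0 u cl s by (simp add: word_val_append)
  then obtain v x where v0: "v0 = v @ inv s # x" and v1: "s \<otimes> word_val L v = s"
    using leave_split[of v0 s s] cl s st by auto
  have cl2: "set v \<subseteq> carrier L" "set x \<subseteq> carrier L" "set v \<subseteq> Z" "set x \<subseteq> Z"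
    using v0 cl by auto
  then have v: "word_val L v = \<one>" using v1 s by simp
  note tc = trail_closed[OF cl2(1)] trail_closed[OF cl2(2)] trail_closed[OF cl(1)]
  define w' where "w' = v @ inv s # u @ x"
  have w: "w = u @ s # v @ inv s # x" using w0 v0 by simp
  have "trail w = trail u \<union> (\<otimes>) s ` trail v \<union> trail x"
  proof -
    have "trail w = trail u \<union> insert \<one> ((\<otimes>) s ` (trail v \<union> insert \<one> ((\<otimes>) (inv s) ` trail x)))"
      using u v w s cl cl2 tc by (simp add: trail_append_loop)
    also have "\<dots> = trail u \<union> (\<otimes>) s ` trail v \<union> (\<otimes>) s ` (\<otimes>) (inv s) ` trail x"
      unfolding image_Un image_insert using one_in_trail[of v] one_in_trail[of u] by blast
    finally show ?thesis using s tc by (simp flip: image_mult_mult add: image_mult_one)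
  qed
  moreover have "trail w' = trail v \<union> (\<otimes>) (inv s) ` trail u \<union> (\<otimes>) (inv s) ` trail x"
    using u v s cl cl2 tc one_in_trail[of v]
    by (simp add: w'_def trail_append_loop image_Un insert_absorb Un_assoc)
  ultimately have "trail w' = (\<otimes>) (inv s) ` trail w"
    using s tc by (simp add: image_Un Un_ac image_mult_one flip: image_mult_mult)
  moreover have "word_val L w' = inv s \<otimes> word_val L w"
    using u v s cl cl2 w by (simp add: w'_def word_val_append flip: m_assoc)
  ultimately show ?thesis
    using w cl cl2 s by (intro exI[of _ w']) (auto simp: w'_def)
qed

text \<open>Every rotation shortens the walk, so rotating stops, and then all visited vertices lie in the
  direction of the end. The equation for normal forms records that the old start, which the
  translation by \<open>c\<close> moves to \<open>c\<close>, lies on the geodesic from the new start to the end.\<close>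

lemma walk_from_leaf:
  assumes "set w \<subseteq> Z"
  shows "\<exists>w' c. set w' \<subseteq> Z \<and> c \<in> carrier L \<and> length w' \<le> length w \<and>
    trail w' = (\<otimes>) c ` trail w \<and> word_val L w' = c \<otimes> word_val L w \<and>
    nf (c \<otimes> word_val L w) = nf c @ nf (word_val L w) \<and>
    (\<forall>y\<in>trail w'. y = \<one> \<or> word_val L w' \<noteq> \<one> \<and> starts (hd (nf (word_val L w'))) y)"
  using assms
proof (induction w rule: length_induct)
  case (1 w)
  have wc: "word_val L w \<in> carrier L" "trail w \<subseteq> carrier L"
    using "1.prems" Z_word_closed trail_closed by auto
  show ?case
  proof (cases "\<forall>y\<in>trail w. y = \<one> \<or> word_val L w \<noteq> \<one> \<and> starts (hd (nf (word_val L w))) y")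
    case True
    then show ?thesis
      using "1.prems" wc by (intro exI[of _ w] exI[of _ \<one>]) (auto simp: image_mult_one)
  next
    case False
    then obtain y where y: "y \<in> trail w" "y \<noteq> \<one>"
      "\<not> (word_val L w \<noteq> \<one> \<and> starts (hd (nf (word_val L w))) y)" by blast
    define s where "s = hd (nf y)"
    have yc: "y \<in> carrier L" using y wc by auto
    have nfy: "nf y \<noteq> []" using y yc nf_eq_Nil_iff by auto
    have s: "s \<in> Z" "starts s y"
      using nfy nf_closed[OF yc] hd_in_set[of "nf y"] by (auto simp: s_def starts_def)
    have ns: "\<not> starts s (word_val L w)" using y s by (auto simp: starts_def)
    have sc: "s \<in> carrier L" "inv s \<in> Z" using s Z_closed Z_inv by auto
    obtain w1 where w1: "set w1 \<subseteq> Z" "length w1 < length w"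
      "trail w1 = (\<otimes>) (inv s) ` trail w" "word_val L w1 = inv s \<otimes> word_val L w"
      using rotate_walk[OF "1.prems" y(1) s(2) ns s(1)] by blast
    obtain w' c where w': "set w' \<subseteq> Z" "c \<in> carrier L" "length w' \<le> length w1"
      "trail w' = (\<otimes>) c ` trail w1" "word_val L w' = c \<otimes> word_val L w1"
      "nf (c \<otimes> word_val L w1) = nf c @ nf (word_val L w1)"
      "\<forall>y\<in>trail w'. y = \<one> \<or> word_val L w' \<noteq> \<one> \<and> starts (hd (nf (word_val L w'))) y"
      using "1.IH" w1 by metis
    have nf1: "nf (inv s \<otimes> word_val L w) = inv s # nf (word_val L w)"
      using nf_letter_mult[of "word_val L w" "inv s"] wc sc ns by simp
    have n: "nf (c \<otimes> word_val L w1) = (nf c @ [inv s]) @ nf (word_val L w)"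
      using w'(6) w1(4) nf1 by simp
    have "(nf c @ [inv s]) @ nf (word_val L w) \<in> normal_words"
      using n w1(4) w'(2) wc sc by (metis inv_closed m_closed nf_normal)
    then have "nf c @ [inv s] \<in> normal_words" using normal_words_append by blast
    from nf_val[OF this] have "nf (c \<otimes> inv s) = nf c @ [inv s]"
      using w'(2) sc by (simp add: word_val_append normal_words_closed)
    then show ?thesis
      using w' w1 sc wc n
      by (intro exI[of _ w'] exI[of _ "c \<otimes> inv s"]) (auto simp: m_assoc image_mult_mult)
  qed
qed

text \<open>The walk is first moved to a leaf at its start; the same is then done to the inverse of the
  resulting walk. The second step does not spoil the first: it only prolongs the geodesic between the
  ends at its far side, so that the first letter of its normal form stays the same.\<close>

lemma walk_between_leaves:
  assumes "set w \<subseteq> Z"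
  shows "\<exists>w' c r. set w' \<subseteq> Z \<and> c \<in> carrier L \<and> length w' \<le> length w \<and>
    trail w' = (\<otimes>) c ` trail w \<and> nf (c \<otimes> word_val L w) = nf c @ nf (word_val L w) \<and>
    nf (word_val L w') = nf c @ nf (word_val L w) @ r \<and>
    (word_val L w' = \<one> \<longrightarrow> trail w' = {\<one>}) \<and>
    (\<forall>y\<in>trail w'. (y = \<one> \<or> starts (hd (nf (word_val L w'))) y) \<and>
       (y = word_val L w' \<or> starts (inv (last (nf (word_val L w')))) (inv (word_val L w') \<otimes> y)))"
proof -
  obtain w1 c where w1: "set w1 \<subseteq> Z" "c \<in> carrier L" "length w1 \<le> length w"
    "trail w1 = (\<otimes>) c ` trail w" "word_val L w1 = c \<otimes> word_val L w"
    "nf (c \<otimes> word_val L w) = nf c @ nf (word_val L w)"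
    "\<forall>y\<in>trail w1. y = \<one> \<or> word_val L w1 \<noteq> \<one> \<and> starts (hd (nf (word_val L w1))) y"
    using walk_from_leaf[OF assms] by blast
  define x where "x = word_val L w1"
  have w1c: "set w1 \<subseteq> carrier L" using w1 Z_word_closed by auto
  have x: "x \<in> carrier L" using w1c by (simp add: x_def)
  obtain w2 d where w2: "set w2 \<subseteq> Z" "d \<in> carrier L" "length w2 \<le> length w1"
    "trail w2 = (\<otimes>) d ` trail (word_inv w1)" "word_val L w2 = d \<otimes> inv x"
    "nf (d \<otimes> inv x) = nf d @ nf (inv x)"
    "\<forall>y\<in>trail w2. y = \<one> \<or> word_val L w2 \<noteq> \<one> \<and> starts (hd (nf (word_val L w2))) y"
    using walk_from_leaf[OF Z_word_inv[OF w1(1)]] w1c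
    by (auto simp: word_val_word_inv x_def)
  have w2c: "set w2 \<subseteq> carrier L" using w2 Z_word_closed by auto
  define w' where "w' = word_inv w2"
  define v where "v = x \<otimes> inv d"
  have v: "v \<in> carrier L" using x w2 by (simp add: v_def)
  have val2: "word_val L w2 = inv v" using w2 x by (simp add: v_def inv_mult_group)
  have val': "word_val L w' = v"
    using val2 v by (simp add: w'_def word_val_word_inv w2c)
  have nfv: "nf v = nf x @ nf (inv d)"
  proof -
    have "nf v = word_inv (nf (inv v))" using v by (simp flip: nf_inv)
    also have "inv v = d \<otimes> inv x" using val2 w2 by simp
    also have "word_inv (nf \<dots>) = word_inv (nf (inv x)) @ word_inv (nf d)" using w2 by simp
    finally show ?thesis using x w2 by (simp flip: nf_inv)
  qed
  have tr: "trail w' = trail w1"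
  proof -
    have "trail w' = (\<otimes>) v ` (\<otimes>) d ` (\<otimes>) (inv x) ` trail w1"
      using val2 v w2 w2c w1c x by (simp add: w'_def trail_word_inv x_def)
    also have "\<dots> = (\<otimes>) (v \<otimes> d \<otimes> inv x) ` trail w1"
    proof -
      have "(\<otimes>) (inv x) ` trail w1 \<subseteq> carrier L" using x trail_closed[OF w1c] by auto
      then show ?thesis using v w2(2) x trail_closed[OF w1c] by (simp add: image_mult_mult)
    qed
    also have "v \<otimes> d \<otimes> inv x = \<one>" using x w2 by (simp add: v_def m_assoc)
    finally show ?thesis using trail_closed[OF w1c] by (simp add: image_mult_one)
  qed
  have tr2: "trail w2 = (\<otimes>) (inv v) ` trail w'"
  proof -
    have "word_inv w' = w2" using w2c by (simp add: w'_def word_inv_word_inv)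
    then show ?thesis using trail_word_inv[of w'] w2c val' by (simp add: w'_def set_word_inv)
  qed
  have hdv: "starts (hd (nf v)) y" if "x \<noteq> \<one>" "starts (hd (nf x)) y" for y
    using that nfv x nf_eq_Nil_iff by (auto simp: starts_def)
  show ?thesis
  proof (intro exI conjI ballI impI)
    show "set w' \<subseteq> Z" using w2 Z_word_inv by (simp add: w'_def)
    show "length w' \<le> length w" using w1 w2 by (simp add: w'_def)
    show "trail w' = (\<otimes>) c ` trail w" using tr w1 by simp
    show "nf (word_val L w') = nf c @ nf (word_val L w) @ nf (inv d)"
      using val' nfv w1 by (simp add: x_def)
    show "trail w' = {\<one>}" if "word_val L w' = \<one>"
    proof -
      have "nf x = []" using nfv that val' by auto
      then have "x = \<one>" using x nf_eq_Nil_iff by auto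
      then show ?thesis using w1(7) tr one_in_trail[of w1] by (auto simp: x_def)
    qed
  next
    fix y assume y: "y \<in> trail w'"
    show "y = \<one> \<or> starts (hd (nf (word_val L w'))) y"
      using y tr w1(7) hdv val' by (auto simp: x_def)
    have yc: "y \<in> carrier L" using y tr trail_closed[OF w1c] by auto
    have "inv v \<otimes> y \<in> trail w2" using tr2 y by auto
    then have "inv v \<otimes> y = \<one> \<or> inv v \<noteq> \<one> \<and> starts (hd (nf (inv v))) (inv v \<otimes> y)"
      using w2(7) val2 by auto
    moreover have "y = v" if "inv v \<otimes> y = \<one>"
      using that v yc by (metis inv_equality inv_inv inv_closed)
    moreover have "hd (nf (inv v)) = inv (last (nf v))" if "inv v \<noteq> \<one>"
      using that v nf_eq_Nil_iff[of v] by (auto simp: nf_inv hd_word_inv)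
    ultimately show "y = word_val L w' \<or> starts (inv (last (nf (word_val L w')))) (inv (word_val L w') \<otimes> y)"
      using val' by auto
  qed (use w1 in auto)
qed

lemma length_nf_val: "set w \<subseteq> Z \<Longrightarrow> length (nf (word_val L w)) \<le> length w"
proof (induction w)
  case (Cons a w)
  let ?g = "word_val L w"
  have w: "set w \<subseteq> Z" and a: "a \<in> Z" using Cons.prems by simp_all
  then have ac: "a \<in> carrier L" using Z_closed by blast
  have g: "?g \<in> carrier L" by (rule word_val_closed[OF Z_word_closed[OF w]])
  show ?case
  proof (cases "starts (inv a) ?g")
    case False
    then show ?thesis using Cons.IH[OF w] nf_letter_mult[OF g a] by simp
  next
    case True
    then have ne: "nf ?g \<noteq> []" "hd (nf ?g) = inv a" by (simp_all add: starts_def)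
    define u where "u = tl (nf ?g)"
    have u: "nf ?g = inv a # u"
      unfolding u_def ne(2)[symmetric] by (rule list.collapse[symmetric]) (rule ne(1))
    have un: "u \<in> normal_words"
      using nf_normal[OF g] unfolding u normal_words_Cons by (elim conjE)
    have uc: "word_val L u \<in> carrier L" using normal_words_closed[OF un] by (rule word_val_closed)
    have "inv a \<otimes> word_val L u = ?g" using val_nf[OF g] unfolding u by (simp only: word_val_simps)
    then have "a \<otimes> ?g = word_val L u" using inv_cancel_left(2)[OF ac uc] by (simp only:)
    then have "nf (word_val L (a # w)) = u" using nf_val[OF un] by (simp only: word_val_simps)
    moreover have "length (nf ?g) \<le> length w" using Cons.IH[OF w] .
    ultimately show ?thesis unfolding u by simp
  qed
qed simp

text \<open>Walk to every vertex of \<open>S\<close> and back, and then to \<open>x\<close>.\<close>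

lemma ex_walk_covering:
  assumes "finite S" "S \<subseteq> carrier L" "x \<in> carrier L"
  shows "\<exists>w. set w \<subseteq> Z \<and> S \<subseteq> trail w \<and> word_val L w = x"
  using assms
proof (induction S rule: finite_induct)
  case empty
  then show ?case by (intro exI[of _ "nf x"]) (auto dest: nf_closed)
next
  case (insert s S)
  then obtain w where w: "set w \<subseteq> Z" "S \<subseteq> trail w" "word_val L w = x" by auto
  have s: "s \<in> carrier L" using insert by simp
  define u where "u = nf s"
  have u: "set u \<subseteq> Z" "set u \<subseteq> carrier L" "word_val L u = s"
    using s nf_closed nf_letters_closed by (auto simp: u_def)
  have wc: "set w \<subseteq> carrier L" using w Z_word_closed by blast
  have loop: "word_val L (u @ word_inv u) = \<one>"
    using u s by (simp add: word_val_append set_word_inv word_val_word_inv)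
  have "trail ((u @ word_inv u) @ w) = trail (u @ word_inv u) \<union> trail w"
    by (rule trail_append_loop) (use u wc loop set_word_inv in auto)
  moreover have "s \<in> trail (u @ word_inv u)"
    using word_val_in_trail[of u] u by (simp add: trail_append set_word_inv)
  moreover have "word_val L ((u @ word_inv u) @ w) = x"
    using word_val_append[of "u @ word_inv u" w] u wc loop w insert.prems set_word_inv by auto
  ultimately show ?case
    using w u Z_word_inv[of u] by (intro exI[of _ "(u @ word_inv u) @ w"]) auto
qed

end

section \<open>Cyclically reduced elements and their fundamental domains\<close>

lemma split_common_prefix:
  "\<exists>p u v. xs = p @ u \<and> ys = p @ v \<and> (u = [] \<or> v = [] \<or> hd u \<noteq> hd v)"
proof (induction xs arbitrary: ys)
  case (Cons x xs)
  show ?case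
  proof (cases "ys \<noteq> [] \<and> hd ys = x")
    case True
    then obtain ys' where ys: "ys = x # ys'" by (cases ys) auto
    from Cons.IH[of ys'] obtain p u v
      where "xs = p @ u" "ys' = p @ v" "u = [] \<or> v = [] \<or> hd u \<noteq> hd v" by blast
    then show ?thesis using ys by (intro exI[of _ "x # p"] exI[of _ u] exI[of _ v]) auto
  next
    case False
    then show ?thesis by (intro exI[of _ "[]"] exI[of _ "x # xs"] exI[of _ ys]) auto
  qed
qed auto

context tree_like_group
begin

definition cyclically_reduced :: "'a \<Rightarrow> bool" where
  "cyclically_reduced m \<longleftrightarrow> m \<in> carrier L \<and> nf m \<noteq> [] \<and> hd (nf m) \<noteq> inv (last (nf m))"

lemma ex_two_letters:
  assumes "infinite (carrier L)"
  shows "\<exists>a\<in>Z. \<exists>b\<in>Z. a \<noteq> b"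
proof (rule ccontr)
  assume *: "\<not> ?thesis"
  have "nf g \<in> {[]} \<union> (\<lambda>a. [a]) ` Z" if g: "g \<in> carrier L" for g
  proof (cases "nf g")
    case (Cons a w)
    note c1 = Cons
    have "a # w \<in> normal_words" using g nf_normal[OF g] Cons by simp
    then show ?thesis
    proof (cases w)
      case (Cons b w')
      then have "b \<noteq> inv a" "a \<in> Z" "b \<in> Z"
        using \<open>a # w \<in> normal_words\<close> by (auto simp: normal_words_Cons)
      then show ?thesis using * Z_inv[of a] by auto
    qed (use c1 in \<open>auto simp: normal_words_Cons\<close>)
  qed auto
  then have "nf ` carrier L \<subseteq> {[]} \<union> (\<lambda>a. [a]) ` Z" by blast
  then have "finite (nf ` carrier L)" by (rule finite_subset) (use finite_Z in auto)
  moreover have "inj_on nf (carrier L)" by (auto intro: inj_onI simp: nf_inject)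
  ultimately show False using assms finite_imageD by blast
qed

text \<open>For nonempty \<open>w\<close> a letter can be appended unless it is the inverse of the first or of the last letter
  of \<open>w\<close>. If that excludes all of \<open>Z\<close>, then \<open>Z\<close> has just two elements. They cannot be inverse to each
  other, as then \<open>w\<close> would be a power of one letter and only one letter would be excluded; so they are
  involutions \<open>p\<close> and \<open>q\<close>, and appending both works. If \<open>w\<close> is empty, a letter that is not an
  involution or a pair of distinct involutions does.\<close>

lemma ex_cyclic_extension:
  assumes "infinite (carrier L)" "w \<in> normal_words"
  shows "\<exists>t. t \<noteq> [] \<and> length t \<le> 2 \<and> w @ t \<in> normal_words \<and> hd (w @ t) \<noteq> inv (last t)"
proof -
  obtain a b where ab: "a \<in> Z" "b \<in> Z" "a \<noteq> b" using ex_two_letters assms by blast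
  have ii: "inv (inv x) = x" if "x \<in> Z" for x using that Z_closed by auto
  have single: ?thesis if "x \<in> Z" "w \<noteq> [] \<longrightarrow> x \<noteq> inv (last w) \<and> hd w \<noteq> inv x"
    "w = [] \<longrightarrow> x \<noteq> inv x" for x
    using that assms ii by (intro exI[of _ "[x]"]) (auto simp: normal_words_append normal_words_Cons hd_append)
  show ?thesis
  proof (cases "w = []")
    case True
    show ?thesis
    proof (cases "\<exists>x\<in>Z. x \<noteq> inv x")
      case False
      then show ?thesis
        using ab True by (intro exI[of _ "[a, b]"]) (auto simp: normal_words_Cons)
    qed (use single True in auto)
  next
    case ne: False
    define p q where "p = hd w" "q = last w"
    have w: "set w \<subseteq> Z" using assms by (simp add: normal_words_def)
    have pq: "p \<in> Z" "q \<in> Z" using ne w by (auto simp: p_q_def)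
    show ?thesis
    proof (cases "\<exists>x\<in>Z. x \<noteq> inv q \<and> x \<noteq> inv p")
      case True
      then obtain x where "x \<in> Z" "x \<noteq> inv q" "p \<noteq> inv x" using inv_Z_eq_iff pq by metis
      then show ?thesis using single ne by (auto simp: p_q_def)
    next
      case False
      then have Zpq: "Z \<subseteq> {inv p, inv q}" by blast
      then have npq: "p \<noteq> q" using ab by auto
      show ?thesis
      proof (cases "p = inv q")
        case True
        \<comment> \<open>Here \<open>Z = {p, inv p}\<close>, and a reduced word is a power of one letter.\<close>
        have "last u = hd u" if "u \<noteq> []" "u \<in> normal_words" for u
          using that
        proof (induction u rule: induct_list012)
          case (3 x y zs)
          have "x \<in> Z" "y \<in> Z" "y \<noteq> inv x" using 3 by (auto simp: normal_words_Cons)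
          then have "x = y" using Zpq True pq ii by (metis empty_iff insert_iff subsetD)
          then show ?case using 3 by (auto simp: normal_words_Cons)
        qed auto
        then have False using npq ne assms by (auto simp: p_q_def)
        then show ?thesis ..
      next
        case nq: False
        then have inv: "inv p = p" "inv q = q"
          using Zpq pq ii by (metis empty_iff insert_iff subsetD)+
        have "w @ [p, q] \<in> normal_words"
          using assms inv npq pq by (auto simp: normal_words_append normal_words_Cons p_q_def)
        moreover have "hd (w @ [p, q]) \<noteq> inv (last [p, q])" using ne inv npq by (simp add: p_q_def)
        ultimately show ?thesis by (intro exI[of _ "[p, q]"]) auto
      qed
    qed
  qed
qed

text \<open>The vertex \<open>\<one>\<close> and everything behind the first edge on the way from \<open>\<one>\<close> to \<open>m\<close>. If \<open>m\<close> is cyclically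
  reduced, then it maps this set into itself, and the complement of the image in the set is a
  fundamental domain for \<open>\<langle>m\<rangle>\<close>.\<close>

definition ahead :: "'a \<Rightarrow> 'a \<Rightarrow> bool" where
  "ahead m i \<longleftrightarrow> i = \<one> \<or> starts (hd (nf m)) i"

definition fundamental_domain :: "'a \<Rightarrow> 'a set" where
  "fundamental_domain m = {i \<in> carrier L. ahead m i \<and> \<not> ahead m (inv m \<otimes> i)}"

lemma nf_mult_ahead:
  assumes "i \<in> carrier L" "ahead m i" "nf v \<noteq> []" "v \<in> carrier L" "hd (nf m) \<noteq> inv (last (nf v))"
  shows "nf (v \<otimes> i) = nf v @ nf i"
  using assms by (intro nf_mult) (auto simp: ahead_def starts_def)

lemma ahead_mult:
  assumes "cyclically_reduced m" "i \<in> carrier L" "ahead m i"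
  shows "ahead m (m \<otimes> i)"
  using nf_mult_ahead[of i m m] assms by (auto simp: cyclically_reduced_def ahead_def starts_def)

lemma ahead_pow:
  assumes "cyclically_reduced m" "i \<in> carrier L" "ahead m i"
  shows "ahead m (m [^] (q::nat) \<otimes> i)"
proof (induction q)
  case (Suc q)
  have m: "m \<in> carrier L" using assms by (simp add: cyclically_reduced_def)
  have "m [^] Suc q \<otimes> i = m \<otimes> (m [^] q \<otimes> i)"
    using m assms by (subst nat_pow_Suc2) (simp_all add: m_assoc)
  then show ?case using ahead_mult[OF assms(1) _ Suc] m assms by simp
qed (use assms in simp)

lemma fundamental_domain_closed: "fundamental_domain m \<subseteq> carrier L"
  by (auto simp: fundamental_domain_def)

lemma fundamental_domain_pow:
  assumes "cyclically_reduced m" "i \<in> fundamental_domain m"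
  shows "m [^] Suc q \<otimes> i \<notin> fundamental_domain m"
    and "inv (m [^] Suc q) \<otimes> i \<notin> fundamental_domain m"
proof -
  have m: "m \<in> carrier L" using assms by (simp add: cyclically_reduced_def)
  have i: "i \<in> carrier L" "ahead m i" "\<not> ahead m (inv m \<otimes> i)"
    using assms by (auto simp: fundamental_domain_def)
  have pw: "m [^] Suc q = m \<otimes> m [^] q" using m by (rule nat_pow_Suc2)
  have "inv m \<otimes> (m [^] Suc q \<otimes> i) = m [^] q \<otimes> i"
    unfolding pw using m i by (simp flip: m_assoc)
  then show "m [^] Suc q \<otimes> i \<notin> fundamental_domain m"
    using ahead_pow[OF assms(1) i(1,2), of q] by (simp add: fundamental_domain_def)
  define j where "j = inv (m [^] Suc q) \<otimes> i"
  have j: "j \<in> carrier L" using m i by (simp add: j_def)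
  have "m [^] q \<otimes> j = inv m \<otimes> i"
  proof -
    have "m [^] q \<otimes> j = m [^] q \<otimes> (inv (m [^] q) \<otimes> (inv m \<otimes> i))"
      unfolding j_def pw using m i by (simp add: inv_mult_group m_assoc)
    also have "\<dots> = inv m \<otimes> i" using m i by (simp flip: m_assoc)
    finally show ?thesis .
  qed
  then have "\<not> ahead m j" using ahead_pow[OF assms(1) j, of q] i by auto
  then show "inv (m [^] Suc q) \<otimes> i \<notin> fundamental_domain m"
    by (simp add: fundamental_domain_def j_def)
qed

text \<open>A vertex of \<open>T\<close> outside the domain would be \<open>m i\<close> with \<open>i\<close> ahead of \<open>\<one>\<close>. Seen from \<open>v\<close> it has the normal
  form \<open>t i\<close>, so it lies behind the first edge of \<open>t\<close>; but from the leaf \<open>v\<close> the tree \<open>T\<close> only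
  extends along the last edge of the geodesic from \<open>\<one>\<close> to \<open>v\<close>.\<close>

lemma leaf_tree_subset_fundamental_domain:
  assumes v: "v \<in> carrier L" and m: "cyclically_reduced m" "nf m = nf v @ t" "t \<noteq> []"
    and T: "T \<subseteq> carrier L" "v = \<one> \<Longrightarrow> T = {\<one>}"
      "\<And>y. y \<in> T \<Longrightarrow> y = \<one> \<or> starts (hd (nf v)) y"
      "\<And>y. y \<in> T \<Longrightarrow> y = v \<or> starts (inv (last (nf v))) (inv v \<otimes> y)"
  shows "T \<subseteq> fundamental_domain m"
proof
  fix y assume y: "y \<in> T"
  then have yc: "y \<in> carrier L" using T by auto
  have mc: "m \<in> carrier L" using m by (simp add: cyclically_reduced_def)
  have "ahead m y"
    using T(2,3) y v m nf_eq_Nil_iff by (cases "v = \<one>") (auto simp: ahead_def starts_def)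
  moreover have False if a: "ahead m (inv m \<otimes> y)"
  proof -
    define i where "i = inv m \<otimes> y"
    have i: "i \<in> carrier L" "ahead m i" using mc yc a by (auto simp: i_def)
    have tn: "t \<in> normal_words" "hd t \<noteq> inv (last (nf v)) \<or> nf v = []"
      using nf_normal[OF mc] m by (auto simp: normal_words_append)
    have tc: "set t \<subseteq> carrier L" using tn normal_words_closed by auto
    have mv: "m = v \<otimes> word_val L t"
      using val_nf[OF mc] m v tc by (simp add: word_val_append normal_words_closed)
    have "inv v \<otimes> y = word_val L t \<otimes> i"
      using mv v tc yc by (simp add: i_def inv_mult_group m_assoc)
        (simp flip: m_assoc)
    moreover have "nf (word_val L t \<otimes> i) = t @ nf i"
      using nf_mult_ahead[OF i, of "word_val L t"] m tn tc
      by (auto simp: nf_val cyclically_reduced_def)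
    ultimately have nf: "nf (inv v \<otimes> y) = t @ nf i" by simp
    show False
    proof (cases "y = v")
      case True
      then show False using nf v m by simp
    next
      case False
      then have "v \<noteq> \<one>" "starts (inv (last (nf v))) (inv v \<otimes> y)" using T(2,4) y by auto
      then show False using nf tn m v nf_eq_Nil_iff by (auto simp: starts_def)
    qed
  qed
  ultimately show "y \<in> fundamental_domain m" using yc by (auto simp: fundamental_domain_def)
qed

lemma not_cyclically_reduced_conjugate:
  assumes "cyclically_reduced m" "nf m = word_inv u @ v @ u" "set u \<subseteq> carrier L"
  shows "u = []"
  using assms by (cases "u = []") (auto simp: cyclically_reduced_def hd_word_inv)

text \<open>Cut \<open>l\<close> and \<open>m\<close> after their longest common prefix \<open>p\<close>, as \<open>l = p u\<close> and \<open>m = p v\<close>. If \<open>p\<close>, \<open>u\<close> and \<open>v\<close> are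
  all nonempty, then \<open>u\<inverse> v p u\<close> is a reduced word for \<open>m'\<close> that is not cyclically reduced. If \<open>v\<close> is
  empty, then \<open>m\<inverse> l\<close> is shorter than \<open>l\<close>. Hence \<open>u\<close> is empty or \<open>p\<close> is. The same holds for \<open>m\<inverse>\<close>, and if
  \<open>l\<close> starts with the first letter of neither, then \<open>l\<inverse> m l\<close> is reduced, which is impossible for
  nontrivial \<open>l\<close>.\<close>

lemma nf_conjugator:
  assumes m: "cyclically_reduced m" and m': "cyclically_reduced m'"
    and l: "l \<in> carrier L" "m \<otimes> l = l \<otimes> m'"
    and short: "length (nf l) \<le> length (nf (m \<otimes> l))" "length (nf l) \<le> length (nf (inv m \<otimes> l))"
  shows "\<exists>k\<le>length (nf m). nf l = take k (nf m) \<or> nf l = take k (nf (inv m))"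
proof -
  have half: "(\<exists>k\<le>length (nf m). nf l = take k (nf m)) \<or> hd (nf l) \<noteq> hd (nf m)"
    if m: "cyclically_reduced m" and m': "cyclically_reduced m'" and eq: "m \<otimes> l = l \<otimes> m'"
      and short: "length (nf l) \<le> length (nf (inv m \<otimes> l))" for m m'
  proof -
    obtain p u v where puv: "nf l = p @ u" "nf m = p @ v" "u = [] \<or> v = [] \<or> hd u \<noteq> hd v"
      using split_common_prefix by blast
    have mc: "m \<in> carrier L" "m' \<in> carrier L" using m m' by (auto simp: cyclically_reduced_def)
    have n: "p @ u \<in> normal_words" "p @ v \<in> normal_words"
      using nf_normal[OF mc(1)] nf_normal[OF l(1)] puv by auto
    then have cl: "set p \<subseteq> carrier L" "set u \<subseteq> carrier L" "set v \<subseteq> carrier L"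
      using normal_words_closed by fastforce+
    let ?p = "word_val L p" and ?u = "word_val L u" and ?v = "word_val L v"
    have lm: "l = ?p \<otimes> ?u" "m = ?p \<otimes> ?v"
      using val_nf[OF mc(1)] val_nf[OF l(1)] puv cl by (simp_all add: word_val_append)
    show ?thesis
    proof (cases "u = [] \<or> p = []")
      case True
      then show ?thesis
      proof
        assume "u = []"
        then show ?thesis using puv by (intro disjI1 exI[of _ "length p"]) auto
      next
        assume p: "p = []"
        show ?thesis
        proof (cases "u = []")
          case True
          then show ?thesis using puv by (intro disjI1 exI[of _ "length p"]) auto
        next
          case False
          then show ?thesis using p puv m by (auto simp: cyclically_reduced_def)
        qed
      qed
    next
      case False
      show ?thesis
      proof (cases "v = []")
        case True
        then have "inv m \<otimes> l = ?u" using lm cl by (simp flip: m_assoc)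
        then have "nf (inv m \<otimes> l) = u" using n nf_val by (simp add: normal_words_append)
        then show ?thesis using short puv False by simp
      next
        case vne: False
        have "m' = inv l \<otimes> (m \<otimes> l)" unfolding eq using mc l(1) by (simp flip: m_assoc)
        also have "\<dots> = word_val L (word_inv u @ v @ p @ u)"
          unfolding lm using cl
          by (simp add: word_val_append word_val_word_inv set_word_inv inv_mult_group m_assoc)
            (simp flip: m_assoc)
        finally have m'eq: "m' = word_val L (word_inv u @ v @ p @ u)" .
        have "hd v \<noteq> inv (last (word_inv u))" 
          using puv False vne hd_last_closed[OF cl(2)] by (auto simp: last_word_inv)
        moreover have "hd p \<noteq> inv (last v)" using m puv vne False by (auto simp: cyclically_reduced_def)
        ultimately have "word_inv u @ v @ p @ u \<in> normal_words"

          using n normal_words_inv[of u] vne False by (auto simp: normal_words_append)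
        then have "nf m' = word_inv u @ (v @ p) @ u" using nf_val m'eq by simp
        then show ?thesis using not_cyclically_reduced_conjugate[OF m'] cl False by blast
      qed
    qed
  qed
  have mc: "m \<in> carrier L" "m' \<in> carrier L" using m m' by (auto simp: cyclically_reduced_def)
  have ci: "cyclically_reduced (inv x)" if "cyclically_reduced x" for x
    using that hd_last_closed[OF nf_letters_closed, of x]
    by (auto simp: cyclically_reduced_def nf_inv hd_word_inv last_word_inv)
  have "inv m \<otimes> l = l \<otimes> inv m'"
  proof -
    have "inv m \<otimes> (m \<otimes> l) \<otimes> inv m' = l \<otimes> inv m'" using mc l(1) by (simp flip: m_assoc)
    moreover have "inv m \<otimes> (l \<otimes> m') \<otimes> inv m' = inv m \<otimes> l" using mc l(1) by (simp add: m_assoc)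
    ultimately show ?thesis using l(2) by simp
  qed
  with half[OF m m' l(2) short(2)] half[OF ci[OF m] ci[OF m']] short mc
  have "?thesis \<or> hd (nf l) \<noteq> hd (nf m) \<and> hd (nf l) \<noteq> hd (nf (inv m))"
    by (auto simp: nf_inv)
  moreover have "nf l = []" if h: "hd (nf l) \<noteq> hd (nf m)" "hd (nf l) \<noteq> hd (nf (inv m))"
  proof (rule ccontr)
    assume ne: "nf l \<noteq> []"
    let ?w = "word_inv (nf l) @ nf m @ nf l"
    have lc: "set (nf l) \<subseteq> carrier L" using l nf_letters_closed by blast
    have "nf m \<noteq> []" using m by (simp add: cyclically_reduced_def)
    then have "?w \<in> normal_words"
      using ne h mc l(1) hd_last_closed[OF lc] normal_words_inv[of "nf l"]
      by (auto simp: normal_words_append nf_inv hd_word_inv last_word_inv)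
    moreover have "word_val L ?w = m'"
    proof -
      have "word_val L ?w = inv l \<otimes> (m \<otimes> l)"
        using l(1) mc lc by (simp add: word_val_append word_val_word_inv set_word_inv normal_words_closed)
      also have "\<dots> = m'" unfolding l(2) using l(1) mc by (simp flip: m_assoc)
      finally show ?thesis .
    qed
    ultimately have "nf m' = ?w" using nf_val by metis
    then show False using not_cyclically_reduced_conjugate[OF m' _ lc] ne by blast
  qed
  ultimately show ?thesis by fastforce
qed

lemma inj_power_orbit:
  assumes "cyclically_reduced m" "i \<in> fundamental_domain m"
  shows "inj (\<lambda>q::nat. m [^] q \<otimes> i)" "inj (\<lambda>q::nat. inv (m [^] q) \<otimes> i)"
proof -
  have m: "m \<in> carrier L" and i: "i \<in> carrier L"
    using assms fundamental_domain_closed by (auto simp: cyclically_reduced_def)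
  have *: "m [^] p \<noteq> m [^] q" if "p < q" for p q :: nat
  proof
    assume eq: "m [^] p = m [^] q"
    from less_imp_Suc_add[OF that] obtain k where "q = Suc (p + k)" by blast
    then have q: "q = p + Suc k" by simp
    have "m [^] p \<otimes> m [^] Suc k = m [^] q" unfolding q by (rule nat_pow_mult[OF m])
    also have "\<dots> = m [^] p \<otimes> \<one>" unfolding eq using m by simp
    finally have "m [^] Suc k = \<one>"
      by (rule l_cancel) (use m in auto)
    then have "m [^] Suc k \<otimes> i = i" using i by (simp only: l_one)
    then show False using fundamental_domain_pow(1)[OF assms, of k] assms(2) by (simp only: not_True_eq_False)
  qed
  have eq: "p = q" if "m [^] p = m [^] q" for p q :: nat
    using *[of p q] *[of q p] that by (cases p q rule: linorder_cases) auto
  show "inj (\<lambda>q::nat. m [^] q \<otimes> i)"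
  proof (rule injI)
    fix p q :: nat assume "m [^] p \<otimes> i = m [^] q \<otimes> i"
    then have "m [^] p = m [^] q" using m i by simp
    then show "p = q" by (rule eq)
  qed
  show "inj (\<lambda>q::nat. inv (m [^] q) \<otimes> i)"
  proof (rule injI)
    fix p q :: nat assume "inv (m [^] p) \<otimes> i = inv (m [^] q) \<otimes> i"
    then have "inv (m [^] p) = inv (m [^] q)" using m i by simp
    then have "m [^] p = m [^] q" using m by (metis inv_inv nat_pow_closed)
    then show "p = q" by (rule eq)
  qed
qed

text \<open>By assumption the value can only change at the step of the orbit that arrives in the fundamental
  domain, and there is just one such step.\<close>

lemma constant_along_orbit:
  assumes m: "cyclically_reduced m" and i: "i \<in> fundamental_domain m"
    and f: "\<And>j. j \<in> carrier L \<Longrightarrow> j \<notin> fundamental_domain m \<Longrightarrow> f j = f (inv m \<otimes> j)"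
  shows "f (m [^] q \<otimes> i) = f i" "f (inv (m [^] Suc q) \<otimes> i) = f (inv m \<otimes> i)"
proof -
  have mc: "m \<in> carrier L" and ic: "i \<in> carrier L"
    using m i fundamental_domain_closed by (auto simp: cyclically_reduced_def)
  show "f (m [^] q \<otimes> i) = f i"
  proof (induction q)
    case (Suc q)
    have "inv m \<otimes> (m [^] Suc q \<otimes> i) = m [^] q \<otimes> i"
      unfolding nat_pow_Suc2[OF mc] using mc ic by (simp flip: m_assoc)
    then have "f (m [^] Suc q \<otimes> i) = f (m [^] q \<otimes> i)"
      using f[OF _ fundamental_domain_pow(1)[OF m i], of q] mc ic
      by (simp only: m_closed nat_pow_closed)
    then show ?case using Suc by simp
  qed (use ic in simp)
  show "f (inv (m [^] Suc q) \<otimes> i) = f (inv m \<otimes> i)"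
  proof (induction q)
    case (Suc q)
    have "inv m \<otimes> (inv (m [^] Suc q) \<otimes> i) = inv (m [^] Suc (Suc q)) \<otimes> i"
      using mc ic by (simp add: inv_mult_group m_assoc)
    then have "f (inv (m [^] Suc q) \<otimes> i) = f (inv (m [^] Suc (Suc q)) \<otimes> i)"
      using f[OF _ fundamental_domain_pow(2)[OF m i], of q] mc ic
      by (simp only: m_closed inv_closed nat_pow_closed)
    then show ?case using Suc by simp
  qed (use mc ic in simp)
qed

text \<open>Every element is a prefix of a cyclically reduced one, and each of these has finitely many prefixes.\<close>

lemma infinite_cyclically_reduced:
  assumes "infinite (carrier L)"
  shows "infinite {m. cyclically_reduced m}"
proof
  assume fin: "finite {m. cyclically_reduced m}"
  have "carrier L \<subseteq> (\<Union>m\<in>{m. cyclically_reduced m}. (\<lambda>k. word_val L (take k (nf m))) ` {..length (nf m)})"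
  proof
    fix g assume g: "g \<in> carrier L"
    obtain t where t: "t \<noteq> []" "nf g @ t \<in> normal_words" "hd (nf g @ t) \<noteq> inv (last t)"
      using ex_cyclic_extension[OF assms nf_normal[OF g]] by blast
    define m where "m = word_val L (nf g @ t)"
    have nfm: "nf m = nf g @ t" using t by (simp add: m_def nf_val)
    moreover have "m \<in> carrier L"
      unfolding m_def using normal_words_closed[OF t(2)] by (rule word_val_closed)
    ultimately have "cyclically_reduced m" using t by (auto simp: cyclically_reduced_def)
    moreover have "g = word_val L (take (length (nf g)) (nf m))" using nfm g by simp
    moreover have "length (nf g) \<le> length (nf m)" using nfm by simp
    ultimately show "g \<in> (\<Union>m\<in>{m. cyclically_reduced m}. (\<lambda>k. word_val L (take k (nf m))) ` {..length (nf m)})"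
      by blast
  qed
  then show False using assms fin finite_subset by blast
qed

end

section \<open>The group with generators \<open>a\<^sub>i\<close>, \<open>b\<^sub>j\<close> and relators \<open>b\<^sub>j\<^sup>2\<close>\<close>

lemma words_simps [simp]:
  "[] \<in> words S" "x # w \<in> words S \<longleftrightarrow> fst x \<in> S \<and> w \<in> words S"
  "u @ v \<in> words S \<longleftrightarrow> u \<in> words S \<and> v \<in> words S"
  by (auto simp: words_def mem_Times_iff)

lemma pres_rel_words: "(u, v) \<in> pres_rel S R \<Longrightarrow> u \<in> words S \<and> v \<in> words S"
  by (induction rule: pres_rel.induct) auto

lemma equiv_pres_rel: "equiv (words S) (pres_rel S R)"
proof (rule equivI)
  show "pres_rel S R \<subseteq> words S \<times> words S" using pres_rel_words by auto
  show "refl_on (words S) (pres_rel S R)" by (simp add: refl_on_def pres_rel.refl)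
  show "sym (pres_rel S R)" by (rule symI) (rule pres_rel.sym)
  show "trans (pres_rel S R)" by (rule transI) (rule pres_rel.trans)
qed

lemma pres_rel_append_left:
  "(u, v) \<in> pres_rel S R \<Longrightarrow> w \<in> words S \<Longrightarrow> (w @ u, w @ v) \<in> pres_rel S R"
proof (induction rule: pres_rel.induct)
  case (cancel u v s b)
  then show ?case using pres_rel.cancel[of "w @ u" S v s b R] by simp
next
  case (relator u v r)
  then show ?case using pres_rel.relator[of "w @ u" S v r R] by simp
next
  case (sym u v)
  show ?case by (rule pres_rel.sym) (rule sym.IH[OF sym.prems])
next
  case (trans u v x)
  show ?case by (rule pres_rel.trans) (rule trans.IH(1)[OF trans.prems] trans.IH(2)[OF trans.prems])+
qed (simp add: pres_rel.refl)

lemma pres_rel_append_right: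
  "(u, v) \<in> pres_rel S R \<Longrightarrow> w \<in> words S \<Longrightarrow> (u @ w, v @ w) \<in> pres_rel S R"
proof (induction rule: pres_rel.induct)
  case (cancel u v s b)
  then show ?case using pres_rel.cancel[of u S "v @ w" s b R] by simp
next
  case (relator u v r)
  then show ?case using pres_rel.relator[of u S "v @ w" r R] by simp
next
  case (sym u v)
  show ?case by (rule pres_rel.sym) (rule sym.IH[OF sym.prems])
next
  case (trans u v x)
  show ?case by (rule pres_rel.trans) (rule trans.IH(1)[OF trans.prems] trans.IH(2)[OF trans.prems])+
qed (simp add: pres_rel.refl)

lemma word_class_eq_iff:
  "u \<in> words S \<Longrightarrow> v \<in> words S \<Longrightarrow>
    word_class S R u = word_class S R v \<longleftrightarrow> (u, v) \<in> pres_rel S R"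
  unfolding word_class_def by (rule eq_equiv_class_iff[OF equiv_pres_rel])

lemma carrier_presented_group: "carrier (presented_group S R) = word_class S R ` words S"
  by (auto simp: presented_group_def quotient_def word_class_def)

lemma one_presented_group: "\<one>\<^bsub>presented_group S R\<^esub> = word_class S R []"
  by (simp add: presented_group_def)

lemma mult_presented_group:
  assumes "u \<in> words S" "v \<in> words S"
  shows "word_class S R u \<otimes>\<^bsub>presented_group S R\<^esub> word_class S R v = word_class S R (u @ v)"
proof -
  have "word_class S R (a @ b) = word_class S R (u @ v)"
    if "a \<in> word_class S R u" "b \<in> word_class S R v" for a b
  proof -
    have ab: "(u, a) \<in> pres_rel S R" "(v, b) \<in> pres_rel S R" using that by (auto simp: word_class_def)
    then have w: "a \<in> words S" "b \<in> words S" using pres_rel_words by blast+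
    have "(u @ v, a @ b) \<in> pres_rel S R"
      using pres_rel_append_right[OF ab(1) assms(2)] pres_rel_append_left[OF ab(2) w(1)]
      by (rule pres_rel.trans)
    then have "(a @ b, u @ v) \<in> pres_rel S R" by (rule pres_rel.sym)
    then show ?thesis using w assms by (simp add: word_class_eq_iff)
  qed
  moreover have "u \<in> word_class S R u" "v \<in> word_class S R v"
    using assms by (auto simp: word_class_def intro: pres_rel.refl)
  ultimately have "(\<Union>a\<in>word_class S R u. \<Union>b\<in>word_class S R v. word_class S R (a @ b)) =
      word_class S R (u @ v)" by blast
  then show ?thesis by (simp add: presented_group_def)
qed

lemma word_class_cancel:
  "s \<in> S \<Longrightarrow> word_class S R [(s, b), (s, \<not> b)] = word_class S R []"
  using pres_rel.cancel[of "[]" S "[]" s b R] by (simp add: word_class_eq_iff)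

lemma presented_group_cases:
  assumes "x \<in> carrier (presented_group S R)"
  obtains u where "u \<in> words S" "x = word_class S R u"
  using assms by (auto simp: carrier_presented_group)

lemma word_class_closed: "u \<in> words S \<Longrightarrow> word_class S R u \<in> carrier (presented_group S R)"
  by (simp add: carrier_presented_group)

lemma group_presented_group: "group (presented_group S R)"
proof (rule groupI)
  fix x y assume x: "x \<in> carrier (presented_group S R)" and y: "y \<in> carrier (presented_group S R)"
  obtain u v where uv: "u \<in> words S" "x = word_class S R u" "v \<in> words S" "y = word_class S R v"
    using x y presented_group_cases by metis
  then show "x \<otimes>\<^bsub>presented_group S R\<^esub> y \<in> carrier (presented_group S R)"
    by (simp add: mult_presented_group word_class_closed)
  fix z assume z: "z \<in> carrier (presented_group S R)"
  then obtain w where w: "w \<in> words S" "z = word_class S R w" by (rule presented_group_cases)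
  show "x \<otimes>\<^bsub>presented_group S R\<^esub> y \<otimes>\<^bsub>presented_group S R\<^esub> z =
      x \<otimes>\<^bsub>presented_group S R\<^esub> (y \<otimes>\<^bsub>presented_group S R\<^esub> z)"
    using uv w by (simp add: mult_presented_group)
next
  show "\<one>\<^bsub>presented_group S R\<^esub> \<in> carrier (presented_group S R)"
    by (simp add: one_presented_group word_class_closed)
next
  fix x assume "x \<in> carrier (presented_group S R)"
  then obtain u where u: "u \<in> words S" "x = word_class S R u" by (rule presented_group_cases)
  then show "\<one>\<^bsub>presented_group S R\<^esub> \<otimes>\<^bsub>presented_group S R\<^esub> x = x"
    by (simp add: one_presented_group mult_presented_group)
  have "\<exists>v\<in>words S. word_class S R (v @ u) = word_class S R []"
    using u(1)
  proof (induction u)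
    case Nil
    show ?case by (rule bexI[of _ "[]"]) simp_all
  next
    case (Cons a u)
    then obtain v where v: "v \<in> words S" "word_class S R (v @ u) = word_class S R []" by auto
    obtain s b where a: "a = (s, b)" by (cases a)
    have "(v @ [(s, \<not> b), (s, \<not> \<not> b)] @ u, v @ u) \<in> pres_rel S R"
      using Cons.prems v a by (intro pres_rel.cancel) auto
    then have "word_class S R ((v @ [(s, \<not> b)]) @ a # u) = word_class S R (v @ u)"
      using Cons.prems v a by (simp add: word_class_eq_iff)
    then show ?case using v Cons.prems a by (intro bexI[of _ "v @ [(s, \<not> b)]"]) simp_all
  qed
  then obtain v where v: "v \<in> words S" "word_class S R (v @ u) = word_class S R []" ..
  show "\<exists>y\<in>carrier (presented_group S R). y \<otimes>\<^bsub>presented_group S R\<^esub> x = \<one>\<^bsub>presented_group S R\<^esub>"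
    using u v by (intro bexI[of _ "word_class S R v"])
      (simp_all add: one_presented_group mult_presented_group word_class_closed)
qed

lemma word_val_presented_group:
  "w \<in> words S \<Longrightarrow> word_val (presented_group S R) (map (\<lambda>x. word_class S R [x]) w) = word_class S R w"
  by (induction w) (auto simp: one_presented_group mult_presented_group)

fun canonical_letter :: "tree_gen \<times> bool \<Rightarrow> tree_gen \<times> bool" where
  "canonical_letter (GenA i, b) = (GenA i, b)"
| "canonical_letter (GenB j, b) = (GenB j, True)"

fun letter_inv :: "tree_gen \<times> bool \<Rightarrow> tree_gen \<times> bool" where
  "letter_inv (GenA i, b) = (GenA i, \<not> b)"
| "letter_inv (GenB j, b) = (GenB j, True)"

lemma letter_inv_simps [simp]:
  "letter_inv (letter_inv x) = canonical_letter x"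
  "canonical_letter (letter_inv x) = letter_inv x"
  "letter_inv (canonical_letter x) = letter_inv x"
  "canonical_letter (canonical_letter x) = canonical_letter x"
  "fst (letter_inv x) = fst x"
  by (cases x rule: letter_inv.cases; simp)+

definition canonical_word :: "tree_gen word \<Rightarrow> bool" where
  "canonical_word w \<longleftrightarrow> (\<forall>x\<in>set w. canonical_letter x = x) \<and> successively (\<lambda>x y. y \<noteq> letter_inv x) w"

text \<open>Left multiplication of a reduced word by a letter. On canonical words these maps satisfy the defining
  relations, so the presented group acts on the canonical words, and a canonical word \<open>w\<close> takes \<open>[]\<close> to
  \<open>w\<close>.\<close>

definition push :: "tree_gen \<times> bool \<Rightarrow> tree_gen word \<Rightarrow> tree_gen word" where
  "push x w = (if w \<noteq> [] \<and> hd w = letter_inv x then tl w else canonical_letter x # w)"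

lemma canonical_word_Nil [simp]: "canonical_word []"
  and canonical_word_Cons: "canonical_word (x # w) \<longleftrightarrow>
    canonical_letter x = x \<and> canonical_word w \<and> (w \<noteq> [] \<longrightarrow> hd w \<noteq> letter_inv x)"
  by (auto simp: canonical_word_def successively_Cons)

lemma canonical_word_push: "canonical_word w \<Longrightarrow> canonical_word (push x w)"
  by (cases w) (auto simp: push_def canonical_word_Cons)

lemma push_push_inv:
  assumes "canonical_word w" "letter_inv y = canonical_letter x" "canonical_letter y = letter_inv x"
  shows "push x (push y w) = w"
  using assms by (cases w) (auto simp: push_def canonical_word_Cons)

lemma canonical_word_foldr_push: "canonical_word w \<Longrightarrow> canonical_word (foldr push u w)"
  by (induction u) (auto intro: canonical_word_push)

lemma foldr_push_pres_rel:
  "(u, v) \<in> pres_rel S (tree_relators N) \<Longrightarrow> canonical_word w \<Longrightarrow> foldr push u w = foldr push v w"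
proof (induction arbitrary: w rule: pres_rel.induct)
  case (cancel u v s b)
  have "letter_inv (s, \<not> b) = canonical_letter (s, b)" "canonical_letter (s, \<not> b) = letter_inv (s, b)"
    by (cases s; simp)+
  then show ?case using cancel by (simp add: push_push_inv canonical_word_foldr_push)
next
  case (relator u v r)
  then obtain j where "r = [(GenB j, True), (GenB j, True)]" by (auto simp: tree_relators_def)
  then show ?case using relator by (simp add: push_push_inv canonical_word_foldr_push)
qed auto

lemma foldr_push_canonical: "canonical_word w \<Longrightarrow> foldr push w [] = w"
  by (induction w) (auto simp: canonical_word_Cons push_def)

definition tree_letters :: "nat \<Rightarrow> nat \<Rightarrow> (tree_gen \<times> bool) set" where
  "tree_letters M N = {x. fst x \<in> tree_gens M N \<and> canonical_letter x = x}"

lemma group_tree_group: "group (tree_group M N)"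
  by (simp add: tree_group_def group_presented_group)

lemma inv_word_class_letter:
  assumes "fst x \<in> tree_gens M N" 
  shows "inv\<^bsub>tree_group M N\<^esub> word_class (tree_gens M N) (tree_relators N) [x] =
    word_class (tree_gens M N) (tree_relators N) [letter_inv x]"
proof -
  let ?S = "tree_gens M N" and ?R = "tree_relators N"
  interpret group "tree_group M N" by (rule group_tree_group)
  have "word_class ?S ?R [letter_inv x, x] = word_class ?S ?R []"
  proof (cases x rule: letter_inv.cases)
    case (1 i b)
    then show ?thesis using word_class_cancel[of "GenA i" ?S ?R "\<not> b"] assms by simp
  next
    case (2 j b)
    show ?thesis
    proof (cases b)
      case True
      have "[(GenB j, True), (GenB j, True)] \<in> ?R"
        using assms 2 by (auto simp: tree_relators_def tree_gens_def)
      then have "([] @ [(GenB j, True), (GenB j, True)] @ [], [] @ []) \<in> pres_rel ?S ?R"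
        using assms 2 by (intro pres_rel.relator) auto
      then show ?thesis using True 2 assms by (simp add: word_class_eq_iff)
    next
      case False
      then show ?thesis using 2 word_class_cancel[of "GenB j" ?S ?R True] assms by simp
    qed
  qed
  then have "word_class ?S ?R [letter_inv x] \<otimes>\<^bsub>tree_group M N\<^esub> word_class ?S ?R [x] = \<one>\<^bsub>tree_group M N\<^esub>"
    using assms by (simp add: tree_group_def mult_presented_group one_presented_group)
  then show ?thesis
    using assms by (intro inv_equality) (auto simp: tree_group_def carrier_presented_group)
qed

lemma tree_genset_eq:
  "tree_genset M N = (\<lambda>x. word_class (tree_gens M N) (tree_relators N) [x]) ` tree_letters M N"
proof -
  have "tree_letters M N = (\<Union>i<M. {(GenA i, True), (GenA i, False)}) \<union> (\<Union>j<N. {(GenB j, True)})"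
  proof (rule Set.set_eqI)
    fix x
    show "x \<in> tree_letters M N \<longleftrightarrow>
        x \<in> (\<Union>i<M. {(GenA i, True), (GenA i, False)}) \<union> (\<Union>j<N. {(GenB j, True)})"
      by (cases x rule: letter_inv.cases) (auto simp: tree_letters_def tree_gens_def)
  qed
  moreover have "(\<Union>i<M. {tree_elt M N (GenA i), inv\<^bsub>tree_group M N\<^esub> tree_elt M N (GenA i)}) =
      (\<Union>i<M. (\<lambda>x. word_class (tree_gens M N) (tree_relators N) [x]) ` {(GenA i, True), (GenA i, False)})"
    using inv_word_class_letter[of "(GenA _, True)" M N]
    by (intro SUP_cong) (simp_all add: tree_elt_def tree_gens_def)
  ultimately show ?thesis
    by (simp add: tree_genset_def tree_elt_def image_Un image_UN)
qed

text \<open>A word that represents \<open>\<one>\<close> fixes \<open>[]\<close> in the action on canonical words, whereas a reduced word \<open>w\<close> takes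
  \<open>[]\<close> to \<open>w\<close>.\<close>

lemma tree_like_tree_group: "tree_like_group (tree_group M N) (tree_genset M N)"
proof -
  let ?S = "tree_gens M N" and ?R = "tree_relators N"
  let ?e = "\<lambda>x. word_class ?S ?R [x]"
  interpret group "tree_group M N" by (rule group_tree_group)
  have lw: "w \<in> words ?S" if "set w \<subseteq> tree_letters M N" for w
    using that by (auto simp: words_def tree_letters_def)
  have closed: "tree_genset M N \<subseteq> carrier (tree_group M N)"
    unfolding tree_genset_eq tree_group_def carrier_presented_group
    by (rule image_subsetI) (simp add: tree_letters_def)
  show ?thesis
  proof unfold_locales
    show "tree_genset M N \<subseteq> carrier (tree_group M N)" by (rule closed)
    show "inv\<^bsub>tree_group M N\<^esub> x \<in> tree_genset M N" if "x \<in> tree_genset M N" for x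
    proof -
      obtain y where y: "y \<in> tree_letters M N" "x = ?e y" using \<open>x \<in> _\<close> unfolding tree_genset_eq by blast
      then have "inv\<^bsub>tree_group M N\<^esub> x = ?e (letter_inv y)" "letter_inv y \<in> tree_letters M N"
        by (simp_all add: inv_word_class_letter tree_letters_def)
      then show ?thesis unfolding tree_genset_eq by blast
    qed
    show "finite (tree_genset M N)" by (simp add: tree_genset_def)
    show "generate (tree_group M N) (tree_genset M N) = carrier (tree_group M N)"
    proof
      show "generate (tree_group M N) (tree_genset M N) \<subseteq> carrier (tree_group M N)"
        using closed by (rule generate_incl)
      have letter: "?e (s, b) \<in> generate (tree_group M N) (tree_genset M N)" if s: "s \<in> ?S" for s b
      proof -
        have T: "?e (s, True) \<in> tree_genset M N"
          unfolding tree_genset_eq by (rule imageI) (use s in \<open>cases s; simp add: tree_letters_def\<close>)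
        have "inv\<^bsub>tree_group M N\<^esub> ?e (s, True) = ?e (s, False)"
        proof (rule inv_equality)
          show "?e (s, False) \<otimes>\<^bsub>tree_group M N\<^esub> ?e (s, True) = \<one>\<^bsub>tree_group M N\<^esub>"
            using s word_class_cancel[of s ?S ?R False]
            by (simp add: tree_group_def mult_presented_group one_presented_group)
        qed (use s in \<open>auto simp: tree_group_def carrier_presented_group\<close>)
        then show ?thesis
          using T generate.inv[OF T, of "tree_group M N"] generate.incl[OF T] by (cases b) auto
      qed
      have "word_class ?S ?R w \<in> generate (tree_group M N) (tree_genset M N)" if "w \<in> words ?S" for w
        using that
      proof (induction w)
        case Nil
        then show ?case
          using generate.one[of "tree_group M N"] by (simp add: tree_group_def one_presented_group)
      next
        case (Cons x w)
        have "word_class ?S ?R (x # w) = ?e x \<otimes>\<^bsub>tree_group M N\<^esub> word_class ?S ?R w"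
          using Cons.prems by (simp add: tree_group_def mult_presented_group)
        then show ?case using Cons letter[of "fst x" "snd x"] by (simp add: generate.eng)
      qed
      then show "carrier (tree_group M N) \<subseteq> generate (tree_group M N) (tree_genset M N)"
        unfolding tree_group_def carrier_presented_group by blast
    qed
    show "w = []"
      if w: "set w \<subseteq> tree_genset M N" "reduced_word w" "word_val (tree_group M N) w = \<one>\<^bsub>tree_group M N\<^esub>"
      for w
    proof -
      obtain u where u: "w = map ?e u" "set u \<subseteq> tree_letters M N"
        using w(1) 
      proof -
        have "w \<in> lists (?e ` tree_letters M N)" using w(1) by (auto simp: tree_genset_eq)
        then show ?thesis using that unfolding lists_image by auto
      qed
      have "canonical_word u"
        using w(2) u(2) unfolding u(1)
      proof (induction u)
        case (Cons x u)
        then show ?case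
          by (cases u) (auto simp: canonical_word_Cons reduced_word_Cons tree_letters_def inv_word_class_letter)
      qed simp
      moreover have "word_class ?S ?R u = word_class ?S ?R []"
        using w(3) word_val_presented_group[OF lw[OF u(2)], of ?R] u(1)
        by (simp add: tree_group_def one_presented_group)
      then have "foldr push u [] = foldr push [] []"
        using foldr_push_pres_rel[of u "[]" ?S N "[]"] lw[OF u(2)] by (simp add: word_class_eq_iff)
      ultimately show ?thesis using foldr_push_canonical[of u] u by simp
    qed
  qed
qed

section \<open>Word length in the wreath product\<close>

lemma word_length_le:
  "set zs \<subseteq> Z \<Longrightarrow> word_length H Z (word_val H zs) \<le> length zs"
  unfolding word_length_def word_val_def by (rule Least_le) blast

lemma ex_shortest_word:
  assumes "set us \<subseteq> Z" "word_val H us = h"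
  shows "\<exists>zs. set zs \<subseteq> Z \<and> word_val H zs = h \<and> length zs = word_length H Z h"
proof -
  have "\<exists>n zs. set zs \<subseteq> Z \<and> length zs = n \<and> foldr (\<otimes>\<^bsub>H\<^esub>) zs \<one>\<^bsub>H\<^esub> = h"
    using assms by (auto simp: word_val_def)
  from LeastI_ex[OF this] show ?thesis
    by (auto simp: word_length_def word_val_def)
qed

lemma word_length_one [simp]: "word_length H Z \<one>\<^bsub>H\<^esub> = 0"
  using word_length_le[of "[]" Z H] by simp

lemma (in group) ex_word_of_generating_set:
  assumes "finite_symmetric_generating_set G Y" "g \<in> carrier G"
  shows "\<exists>ys. set ys \<subseteq> Y \<and> word_val G ys = g"
proof -
  have Y: "Y \<subseteq> carrier G" "\<And>y. y \<in> Y \<Longrightarrow> inv y \<in> Y"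
    using assms by (auto simp: finite_symmetric_generating_set_def)
  have "g \<in> generate G Y" using assms by (simp add: finite_symmetric_generating_set_def)
  then show ?thesis
  proof (induction rule: generate.induct)
    case one
    show ?case by (rule exI[of _ "[]"]) simp
  next
    case (incl h)
    then show ?case using Y by (intro exI[of _ "[h]"]) auto
  next
    case (inv h)
    then have "inv h \<in> Y" "inv h \<in> carrier G" using Y by auto
    then show ?case by (intro exI[of _ "[inv h]"]) auto
  next
    case (eng g h)
    then obtain us vs where "set us \<subseteq> Y" "word_val G us = g" "set vs \<subseteq> Y" "word_val G vs = h" by blast
    then show ?case using Y by (intro exI[of _ "us @ vs"]) (auto simp: word_val_append)
  qed
qed

locale wreath_groups = G: group G + L: group L
  for G :: "('g, 'n) monoid_scheme" and L :: "('l, 'm) monoid_scheme"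
begin

abbreviation W where "W \<equiv> wreath_product G L"

definition lamps :: "('l \<Rightarrow> 'g) set" where
  "lamps = carrier (sum_group (carrier L) (\<lambda>_. G))"

lemma lamps_iff:
  "\<eta> \<in> lamps \<longleftrightarrow> \<eta> \<in> extensional (carrier L) \<and> (\<forall>i\<in>carrier L. \<eta> i \<in> carrier G) \<and>
    finite {i \<in> carrier L. \<eta> i \<noteq> \<one>\<^bsub>G\<^esub>}"
  by (auto simp: lamps_def carrier_sum_group G.group_axioms PiE_iff)

lemma lamps_eqI:
  "\<eta> \<in> lamps \<Longrightarrow> \<theta> \<in> lamps \<Longrightarrow> (\<And>i. i \<in> carrier L \<Longrightarrow> \<eta> i = \<theta> i) \<Longrightarrow> \<eta> = \<theta>"
  by (auto simp: lamps_iff intro: extensionalityI)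

lemma lamps_closed: "\<eta> \<in> lamps \<Longrightarrow> i \<in> carrier L \<Longrightarrow> \<eta> i \<in> carrier G"
  by (simp add: lamps_iff)

lemma lamps_finite: "\<eta> \<in> lamps \<Longrightarrow> finite {i \<in> carrier L. \<eta> i \<noteq> \<one>\<^bsub>G\<^esub>}"
  by (simp add: lamps_iff)

lemma carrier_wreath: "carrier W = lamps \<times> carrier L"
  by (simp add: wreath_product_def lamps_def)

lemma mult_wreath:
  "(\<eta>, m) \<otimes>\<^bsub>W\<^esub> (\<theta>, n) =
    (\<lambda>i\<in>carrier L. \<eta> i \<otimes>\<^bsub>G\<^esub> \<theta> (inv\<^bsub>L\<^esub> m \<otimes>\<^bsub>L\<^esub> i), m \<otimes>\<^bsub>L\<^esub> n)"
  by (auto simp: wreath_product_def wreath_shift_def)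

lemma one_wreath: "\<one>\<^bsub>W\<^esub> = (\<lambda>i\<in>carrier L. \<one>\<^bsub>G\<^esub>, \<one>\<^bsub>L\<^esub>)"
  by (simp add: wreath_product_def)

lemma wreath_vec_lamps: "g \<in> carrier G \<Longrightarrow> wreath_vec G L g \<in> lamps"
  by (auto simp: wreath_vec_def lamps_iff intro: finite_subset[of _ "{\<one>\<^bsub>L\<^esub>}"])

lemma one_lamps: "(\<lambda>i\<in>carrier L. \<one>\<^bsub>G\<^esub>) \<in> lamps"
  by (simp add: lamps_iff)

lemma shift_lamps:
  assumes "\<theta> \<in> lamps" "m \<in> carrier L"
  shows "wreath_shift L m \<theta> \<in> lamps"
proof -
  have "{i \<in> carrier L. \<theta> (inv\<^bsub>L\<^esub> m \<otimes>\<^bsub>L\<^esub> i) \<noteq> \<one>\<^bsub>G\<^esub>} \<subseteq>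
      (\<otimes>\<^bsub>L\<^esub>) m ` {i \<in> carrier L. \<theta> i \<noteq> \<one>\<^bsub>G\<^esub>}"
  proof safe
    fix i assume i: "i \<in> carrier L" "\<theta> (inv\<^bsub>L\<^esub> m \<otimes>\<^bsub>L\<^esub> i) \<noteq> \<one>\<^bsub>G\<^esub>"
    show "i \<in> (\<otimes>\<^bsub>L\<^esub>) m ` {i \<in> carrier L. \<theta> i \<noteq> \<one>\<^bsub>G\<^esub>}"
      using i assms by (intro image_eqI[of _ _ "inv\<^bsub>L\<^esub> m \<otimes>\<^bsub>L\<^esub> i"]) (auto simp flip: L.m_assoc)
  qed
  then have "finite {i \<in> carrier L. \<theta> (inv\<^bsub>L\<^esub> m \<otimes>\<^bsub>L\<^esub> i) \<noteq> \<one>\<^bsub>G\<^esub>}"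
    by (rule finite_subset) (use assms lamps_finite in auto)
  moreover have "{i \<in> carrier L. wreath_shift L m \<theta> i \<noteq> \<one>\<^bsub>G\<^esub>} =
      {i \<in> carrier L. \<theta> (inv\<^bsub>L\<^esub> m \<otimes>\<^bsub>L\<^esub> i) \<noteq> \<one>\<^bsub>G\<^esub>}"
    by (auto simp: wreath_shift_def)
  ultimately show ?thesis
    using assms by (auto simp: lamps_iff wreath_shift_def)
qed

lemma mult_lamps:
  assumes "\<eta> \<in> lamps" "\<theta> \<in> lamps"
  shows "(\<lambda>i\<in>carrier L. \<eta> i \<otimes>\<^bsub>G\<^esub> \<theta> i) \<in> lamps"
proof -
  have "{i \<in> carrier L. (\<lambda>i\<in>carrier L. \<eta> i \<otimes>\<^bsub>G\<^esub> \<theta> i) i \<noteq> \<one>\<^bsub>G\<^esub>} \<subseteq>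
      {i \<in> carrier L. \<eta> i \<noteq> \<one>\<^bsub>G\<^esub>} \<union> {i \<in> carrier L. \<theta> i \<noteq> \<one>\<^bsub>G\<^esub>}"
    by auto
  then have "finite {i \<in> carrier L. (\<lambda>i\<in>carrier L. \<eta> i \<otimes>\<^bsub>G\<^esub> \<theta> i) i \<noteq> \<one>\<^bsub>G\<^esub>}"
    by (rule finite_subset) (use assms lamps_finite in auto)
  then show ?thesis using assms by (auto simp: lamps_iff)
qed

lemma mult_wreath_shift:
  "m \<in> carrier L \<Longrightarrow> (\<eta>, m) \<otimes>\<^bsub>W\<^esub> (\<theta>, n) =
    (\<lambda>i\<in>carrier L. \<eta> i \<otimes>\<^bsub>G\<^esub> wreath_shift L m \<theta> i, m \<otimes>\<^bsub>L\<^esub> n)"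
  by (auto simp: mult_wreath wreath_shift_def)

lemma group_wreath: "group W"
proof (rule groupI)
  fix x y assume x: "x \<in> carrier W" and y: "y \<in> carrier W"
  obtain \<eta> m \<theta> n where xy: "x = (\<eta>, m)" "y = (\<theta>, n)" by (cases x, cases y)
  then have c: "\<eta> \<in> lamps" "m \<in> carrier L" "\<theta> \<in> lamps" "n \<in> carrier L"
    using x y by (auto simp: carrier_wreath)
  show "x \<otimes>\<^bsub>W\<^esub> y \<in> carrier W"
    using c by (simp add: xy mult_wreath_shift carrier_wreath mult_lamps shift_lamps)
  fix z assume z: "z \<in> carrier W"
  obtain \<rho> k where z': "z = (\<rho>, k)" by (cases z)
  then have c': "\<rho> \<in> lamps" "k \<in> carrier L" using z by (auto simp: carrier_wreath)
  show "x \<otimes>\<^bsub>W\<^esub> y \<otimes>\<^bsub>W\<^esub> z = x \<otimes>\<^bsub>W\<^esub> (y \<otimes>\<^bsub>W\<^esub> z)"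
    using c c'
    by (auto simp: xy z' mult_wreath L.m_assoc G.m_assoc L.inv_mult_group lamps_closed intro!: restrict_ext)
next
  show "\<one>\<^bsub>W\<^esub> \<in> carrier W" by (simp add: one_wreath carrier_wreath one_lamps)
next
  fix x assume x: "x \<in> carrier W"
  obtain \<eta> m where xy: "x = (\<eta>, m)" by (cases x)
  then have c: "\<eta> \<in> lamps" "m \<in> carrier L" using x by (auto simp: carrier_wreath)
  have "(\<lambda>i\<in>carrier L. \<one>\<^bsub>G\<^esub> \<otimes>\<^bsub>G\<^esub> \<eta> i) = \<eta>"
    using c by (intro extensionalityI[of _ "carrier L"]) (auto simp: lamps_iff)
  moreover have "(\<lambda>i\<in>carrier L. (\<lambda>i\<in>carrier L. \<one>\<^bsub>G\<^esub>) i \<otimes>\<^bsub>G\<^esub> \<eta> (inv\<^bsub>L\<^esub> \<one>\<^bsub>L\<^esub> \<otimes>\<^bsub>L\<^esub> i)) =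
      (\<lambda>i\<in>carrier L. \<one>\<^bsub>G\<^esub> \<otimes>\<^bsub>G\<^esub> \<eta> i)"
    by (intro restrict_ext) simp
  ultimately show "\<one>\<^bsub>W\<^esub> \<otimes>\<^bsub>W\<^esub> x = x"
    using c by (simp add: one_wreath mult_wreath xy)
  define \<theta> where "\<theta> = (\<lambda>i\<in>carrier L. inv\<^bsub>G\<^esub> wreath_shift L (inv\<^bsub>L\<^esub> m) \<eta> i)"
  have sh: "wreath_shift L (inv\<^bsub>L\<^esub> m) \<eta> \<in> lamps" using c by (simp add: shift_lamps)
  then have "{i \<in> carrier L. \<theta> i \<noteq> \<one>\<^bsub>G\<^esub>} =
      {i \<in> carrier L. wreath_shift L (inv\<^bsub>L\<^esub> m) \<eta> i \<noteq> \<one>\<^bsub>G\<^esub>}"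
    by (auto simp: \<theta>_def lamps_closed)
  then have "\<theta> \<in> lamps"
    using sh lamps_finite[OF sh] by (auto simp: lamps_iff \<theta>_def)
  moreover have "(\<theta>, inv\<^bsub>L\<^esub> m) \<otimes>\<^bsub>W\<^esub> x = \<one>\<^bsub>W\<^esub>"
    using c lamps_closed[OF sh]
    by (auto simp: xy mult_wreath_shift one_wreath \<theta>_def intro!: restrict_ext)
  ultimately show "\<exists>y\<in>carrier W. y \<otimes>\<^bsub>W\<^esub> x = \<one>\<^bsub>W\<^esub>"
    using c by (intro bexI[of _ "(\<theta>, inv\<^bsub>L\<^esub> m)"]) (auto simp: carrier_wreath)
qed

end

locale tree_lamplighter = wreath_groups G L + L: tree_like_group L Z
  for G :: "('g, 'n) monoid_scheme" and L :: "('l, 'm) monoid_scheme" and Z +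
  fixes Y :: "'g set"
  assumes Y: "finite_symmetric_generating_set G Y"
begin

abbreviation gens where "gens \<equiv> wreath_gens G L Y Z"

abbreviation lamp_cost :: "('l \<Rightarrow> 'g) \<Rightarrow> 'l list \<Rightarrow> nat" where
  "lamp_cost \<eta> w \<equiv> (\<Sum>i\<in>L.trail w. word_length G Y (\<eta> i))"

definition lit_within :: "('l \<Rightarrow> 'g) \<Rightarrow> 'l set \<Rightarrow> bool" where
  "lit_within \<eta> T \<longleftrightarrow> (\<forall>i\<in>carrier L. \<eta> i \<noteq> \<one>\<^bsub>G\<^esub> \<longrightarrow> i \<in> T)"

lemma Y_closed: "Y \<subseteq> carrier G"
  using Y by (simp add: finite_symmetric_generating_set_def)

lemma gens_closed: "gens \<subseteq> carrier W"
  using Y_closed L.Z_closed by (auto simp: wreath_gens_def carrier_wreath wreath_vec_lamps)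

lemma finite_gens: "finite gens"
  using Y L.finite_Z by (auto simp: wreath_gens_def finite_symmetric_generating_set_def)

lemma word_length_mult_gen:
  assumes "y \<in> Y" "g \<in> carrier G"
  shows "word_length G Y (y \<otimes>\<^bsub>G\<^esub> g) \<le> Suc (word_length G Y g)"
proof -
  obtain ys where "set ys \<subseteq> Y" "word_val G ys = g" "length ys = word_length G Y g"
    using G.ex_word_of_generating_set[OF Y assms(2)] ex_shortest_word by metis
  then show ?thesis using word_length_le[of "y # ys" Y G] assms by auto
qed

lemma mult_translation_gen:
  "s \<in> carrier L \<Longrightarrow> \<eta> \<in> lamps \<Longrightarrow>
    (wreath_vec G L \<one>\<^bsub>G\<^esub>, s) \<otimes>\<^bsub>W\<^esub> (\<eta>, x) = (wreath_shift L s \<eta>, s \<otimes>\<^bsub>L\<^esub> x)"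
  by (auto simp: mult_wreath wreath_vec_def wreath_shift_def lamps_closed intro!: restrict_ext)

lemma mult_lamp_gen:
  "g \<in> carrier G \<Longrightarrow> \<eta> \<in> lamps \<Longrightarrow> x \<in> carrier L \<Longrightarrow>
    (wreath_vec G L g, \<one>\<^bsub>L\<^esub>) \<otimes>\<^bsub>W\<^esub> (\<eta>, x) = (\<eta>(\<one>\<^bsub>L\<^esub> := g \<otimes>\<^bsub>G\<^esub> \<eta> \<one>\<^bsub>L\<^esub>), x)"
  by (auto simp: mult_wreath wreath_vec_def lamps_closed lamps_iff extensional_def fun_eq_iff)

lemma sum_trail_Cons_shift:
  assumes "s \<in> carrier L" "set w \<subseteq> carrier L" "\<And>i. i \<in> carrier L \<Longrightarrow> i \<notin> (\<otimes>\<^bsub>L\<^esub>) s ` L.trail w \<Longrightarrow> f i = 0"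
  shows "(\<Sum>i\<in>L.trail (s # w). f i) = (\<Sum>i\<in>L.trail w. f (s \<otimes>\<^bsub>L\<^esub> i) :: nat)"
proof -
  have "(\<Sum>i\<in>L.trail (s # w). f i) = (\<Sum>i\<in>(\<otimes>\<^bsub>L\<^esub>) s ` L.trail w. f i)"
    using assms by (intro sum.mono_neutral_right) auto
  also have "\<dots> = (\<Sum>i\<in>L.trail w. f (s \<otimes>\<^bsub>L\<^esub> i))"
    by (rule sum.reindex_cong[OF L.inj_on_translation[OF assms(1) L.trail_closed[OF assms(2)]] HOL.refl HOL.refl])
  finally show ?thesis .
qed

text \<open>Reading a word over the generators from right to left, a letter from \<open>Z\<close> translates the
  configuration, and a letter from \<open>Y\<close> changes the lamp at \<open>\<one>\<close> and costs one. So the translations in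
  the word form the walk, and the lamp letters pay for the lamps.\<close>

lemma walk_of_word:
  assumes "set zs \<subseteq> gens"
  shows "\<exists>w. set w \<subseteq> Z \<and> word_val L w = snd (word_val W zs) \<and>
    lit_within (fst (word_val W zs)) (L.trail w) \<and>
    length w + lamp_cost (fst (word_val W zs)) w \<le> length zs"
  using assms
proof (induction zs)
  case Nil
  show ?case by (rule exI[of _ "[]"]) (auto simp: one_wreath lit_within_def)
next
  case (Cons z zs)
  interpret W: group W by (rule group_wreath)
  have zc: "set zs \<subseteq> carrier W" using Cons.prems gens_closed by auto
  obtain \<eta> x where e: "word_val W zs = (\<eta>, x)" by fastforce
  then have c: "\<eta> \<in> lamps" "x \<in> carrier L"
    using W.word_val_closed[OF zc] by (auto simp: carrier_wreath)
  obtain w where w: "set w \<subseteq> Z" "word_val L w = x" "lit_within \<eta> (L.trail w)"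
    "length w + lamp_cost \<eta> w \<le> length zs"
    using Cons e by auto
  have wc: "set w \<subseteq> carrier L" using w L.Z_word_closed by blast
  consider s where "s \<in> Z" "z = (wreath_vec G L \<one>\<^bsub>G\<^esub>, s)"
    | y where "y \<in> Y" "z = (wreath_vec G L y, \<one>\<^bsub>L\<^esub>)"
    using Cons.prems by (auto simp: wreath_gens_def)
  then show ?case
  proof cases
    case 1
    then have s: "s \<in> carrier L" using L.Z_closed by auto
    define \<theta> where "\<theta> = wreath_shift L s \<eta>"
    have v: "word_val W (z # zs) = (\<theta>, s \<otimes>\<^bsub>L\<^esub> x)"
      using 1 s c e by (simp add: mult_translation_gen \<theta>_def)
    have lit: "\<theta> i = \<one>\<^bsub>G\<^esub>" if "i \<in> carrier L" "i \<notin> (\<otimes>\<^bsub>L\<^esub>) s ` L.trail w" for i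
    proof -
      have "i = s \<otimes>\<^bsub>L\<^esub> (inv\<^bsub>L\<^esub> s \<otimes>\<^bsub>L\<^esub> i)" using that s by (simp flip: L.m_assoc)
      then have "inv\<^bsub>L\<^esub> s \<otimes>\<^bsub>L\<^esub> i \<notin> L.trail w" using that by blast
      then show ?thesis using w(3) that s by (auto simp: \<theta>_def wreath_shift_def lit_within_def)
    qed
    have "lamp_cost \<theta> (s # w) = (\<Sum>i\<in>L.trail w. word_length G Y (\<theta> (s \<otimes>\<^bsub>L\<^esub> i)))"
      using s wc lit by (intro sum_trail_Cons_shift) auto
    also have "\<dots> = lamp_cost \<eta> w"
    proof (rule sum.cong[OF HOL.refl])
      fix i assume "i \<in> L.trail w"
      then have "i \<in> carrier L" using L.trail_closed wc by auto
      then show "word_length G Y (\<theta> (s \<otimes>\<^bsub>L\<^esub> i)) = word_length G Y (\<eta> i)"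
        using s by (simp add: \<theta>_def wreath_shift_def flip: L.m_assoc)
    qed
    finally have "lamp_cost \<theta> (s # w) = lamp_cost \<eta> w" .
    moreover have "lit_within \<theta> (L.trail (s # w))" using lit by (auto simp: lit_within_def)
    ultimately show ?thesis
      using v w 1 by (intro exI[of _ "s # w"]) auto
  next
    case 2
    then have y: "y \<in> carrier G" using Y_closed by auto
    define \<theta> where "\<theta> = \<eta>(\<one>\<^bsub>L\<^esub> := y \<otimes>\<^bsub>G\<^esub> \<eta> \<one>\<^bsub>L\<^esub>)"
    have v: "word_val W (z # zs) = (\<theta>, x)"
      using 2 y c e by (simp add: mult_lamp_gen \<theta>_def)
    have "lamp_cost \<theta> w \<le> (\<Sum>i\<in>L.trail w. word_length G Y (\<eta> i) + (if i = \<one>\<^bsub>L\<^esub> then 1 else 0))"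
      using word_length_mult_gen[OF 2(1) lamps_closed[OF c(1)]] by (intro sum_mono) (auto simp: \<theta>_def)
    also have "\<dots> = lamp_cost \<eta> w + 1"
      by (simp add: sum.distrib)
    finally have "lamp_cost \<theta> w \<le> lamp_cost \<eta> w + 1" .
    moreover have "lit_within \<theta> (L.trail w)" using w(3) by (auto simp: lit_within_def \<theta>_def)
    ultimately show ?thesis using v w by (intro exI[of _ w]) auto
  qed
qed

lemma word_of_lamp:
  assumes "g \<in> carrier G"
  shows "\<exists>zs. set zs \<subseteq> gens \<and> word_val W zs = (wreath_vec G L g, \<one>\<^bsub>L\<^esub>) \<and> length zs = word_length G Y g"
proof -
  have *: "word_val W (map (\<lambda>y. (wreath_vec G L y, \<one>\<^bsub>L\<^esub>)) ys) = (wreath_vec G L (word_val G ys), \<one>\<^bsub>L\<^esub>)"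
    if "set ys \<subseteq> Y" for ys
    using that
  proof (induction ys)
    case Nil
    show ?case by (auto simp: one_wreath wreath_vec_def)
  next
    case (Cons y ys)
    then have c: "y \<in> carrier G" "word_val G ys \<in> carrier G" using Y_closed by auto
    have "(wreath_vec G L (word_val G ys))(\<one>\<^bsub>L\<^esub> := y \<otimes>\<^bsub>G\<^esub> wreath_vec G L (word_val G ys) \<one>\<^bsub>L\<^esub>) =
        wreath_vec G L (y \<otimes>\<^bsub>G\<^esub> word_val G ys)"
      by (auto simp: wreath_vec_def fun_eq_iff)
    then show ?case using Cons c by (simp add: mult_lamp_gen wreath_vec_lamps)
  qed
  obtain ys where "set ys \<subseteq> Y" "word_val G ys = g" "length ys = word_length G Y g"
    using G.ex_word_of_generating_set[OF Y assms] ex_shortest_word by metis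
  then show ?thesis
    using * by (intro exI[of _ "map (\<lambda>y. (wreath_vec G L y, \<one>\<^bsub>L\<^esub>)) ys"]) (auto simp: wreath_gens_def)
qed

text \<open>The lamp at a vertex is set during one visit only. Here this is the first one: the lamp at the
  start is switched off in \<open>\<theta>\<close> and set by the prefix \<open>us\<close>.\<close>

lemma word_of_walk:
  assumes "set w \<subseteq> Z" "\<eta> \<in> lamps" "lit_within \<eta> (L.trail w)"
  shows "\<exists>zs. set zs \<subseteq> gens \<and> word_val W zs = (\<eta>, word_val L w) \<and>
    length zs = length w + lamp_cost \<eta> w"
  using assms
proof (induction w arbitrary: \<eta>)
  case Nil
  then have "\<eta> = wreath_vec G L (\<eta> \<one>\<^bsub>L\<^esub>)"
    by (intro lamps_eqI) (auto simp: wreath_vec_lamps lamps_closed, auto simp: wreath_vec_def lit_within_def)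
  then show ?case using word_of_lamp[of "\<eta> \<one>\<^bsub>L\<^esub>"] Nil lamps_closed by auto
next
  case (Cons a w)
  interpret W: group W by (rule group_wreath)
  have a: "a \<in> carrier L" "a \<in> Z" and wc: "set w \<subseteq> carrier L"
    using Cons.prems L.Z_closed by auto
  define \<theta> where "\<theta> = \<eta>(\<one>\<^bsub>L\<^esub> := \<one>\<^bsub>G\<^esub>)"
  define \<rho> where "\<rho> = wreath_shift L (inv\<^bsub>L\<^esub> a) \<theta>"
  have \<theta>: "\<theta> \<in> lamps"
  proof -
    have "{i \<in> carrier L. \<theta> i \<noteq> \<one>\<^bsub>G\<^esub>} \<subseteq> {i \<in> carrier L. \<eta> i \<noteq> \<one>\<^bsub>G\<^esub>}"
      by (auto simp: \<theta>_def)
    then have "finite {i \<in> carrier L. \<theta> i \<noteq> \<one>\<^bsub>G\<^esub>}"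
      by (rule finite_subset) (rule lamps_finite[OF Cons.prems(2)])
    then show ?thesis using Cons.prems(2) by (auto simp: lamps_iff \<theta>_def extensional_def)
  qed
  have \<rho>: "\<rho> \<in> lamps" using \<theta> a by (simp add: \<rho>_def shift_lamps)
  have \<rho>_eq: "\<rho> i = \<theta> (a \<otimes>\<^bsub>L\<^esub> i)" if "i \<in> carrier L" for i
    using that a by (simp add: \<rho>_def wreath_shift_def)
  have \<theta>_lit: "\<theta> i = \<one>\<^bsub>G\<^esub>" if "i \<in> carrier L" "i \<notin> (\<otimes>\<^bsub>L\<^esub>) a ` L.trail w" for i
    using that Cons.prems(3) by (auto simp: lit_within_def \<theta>_def)
  have "lit_within \<rho> (L.trail w)"
    unfolding lit_within_def
  proof (intro ballI impI)
    fix i assume i: "i \<in> carrier L" "\<rho> i \<noteq> \<one>\<^bsub>G\<^esub>"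
    then have "a \<otimes>\<^bsub>L\<^esub> i \<in> (\<otimes>\<^bsub>L\<^esub>) a ` L.trail w" using \<theta>_lit[of "a \<otimes>\<^bsub>L\<^esub> i"] a by (auto simp: \<rho>_eq)
    then obtain j where "j \<in> L.trail w" "a \<otimes>\<^bsub>L\<^esub> i = a \<otimes>\<^bsub>L\<^esub> j" by blast
    then show "i \<in> L.trail w" using L.trail_closed[OF wc] a i by auto
  qed
  then obtain zs where zs: "set zs \<subseteq> gens" "word_val W zs = (\<rho>, word_val L w)"
    "length zs = length w + lamp_cost \<rho> w"
    using Cons.IH[of \<rho>] \<rho> Cons.prems by auto
  have \<eta>1: "\<eta> \<one>\<^bsub>L\<^esub> \<in> carrier G" using Cons.prems(2) by (simp add: lamps_closed)
  obtain us where us: "set us \<subseteq> gens" "word_val W us = (wreath_vec G L (\<eta> \<one>\<^bsub>L\<^esub>), \<one>\<^bsub>L\<^esub>)"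
    "length us = word_length G Y (\<eta> \<one>\<^bsub>L\<^esub>)"
    using word_of_lamp[OF \<eta>1] by blast
  define vs where "vs = (wreath_vec G L \<one>\<^bsub>G\<^esub>, a) # zs"
  have vs: "set vs \<subseteq> gens" using a zs by (auto simp: vs_def wreath_gens_def)
  have "wreath_shift L a \<rho> = \<theta>"
    using a \<theta> \<rho> by (intro lamps_eqI) (auto simp: shift_lamps, auto simp: wreath_shift_def \<rho>_eq simp flip: L.m_assoc)
  then have "word_val W vs = (\<theta>, a \<otimes>\<^bsub>L\<^esub> word_val L w)"
    using zs a \<rho> by (simp add: vs_def mult_translation_gen)
  moreover have "\<theta>(\<one>\<^bsub>L\<^esub> := \<eta> \<one>\<^bsub>L\<^esub> \<otimes>\<^bsub>G\<^esub> \<theta> \<one>\<^bsub>L\<^esub>) = \<eta>"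
    using \<eta>1 by (auto simp: \<theta>_def)
  ultimately have "word_val W (us @ vs) = (\<eta>, word_val L (a # w))"
    using us gens_closed vs \<eta>1 \<theta> a wc
    by (subst W.word_val_append) (auto simp: mult_lamp_gen)
  moreover have "length (us @ vs) = length (a # w) + lamp_cost \<eta> (a # w)"
  proof -
    have "lamp_cost \<rho> w = (\<Sum>i\<in>L.trail w. word_length G Y (\<theta> (a \<otimes>\<^bsub>L\<^esub> i)))"
      using L.trail_closed[OF wc] by (intro sum.cong) (auto simp: \<rho>_eq)
    also have "\<dots> = lamp_cost \<theta> (a # w)"
      using a wc \<theta>_lit by (intro sum_trail_Cons_shift[symmetric]) auto
    also have "\<dots> = (\<Sum>i\<in>L.trail (a # w) - {\<one>\<^bsub>L\<^esub>}. word_length G Y (\<theta> i))"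
      by (rule sum.mono_neutral_right) (auto simp: \<theta>_def)
    also have "\<dots> = (\<Sum>i\<in>L.trail (a # w) - {\<one>\<^bsub>L\<^esub>}. word_length G Y (\<eta> i))"
      by (rule sum.cong) (auto simp: \<theta>_def)
    also have "word_length G Y (\<eta> \<one>\<^bsub>L\<^esub>) + \<dots> = lamp_cost \<eta> (a # w)"
      by (rule sum.remove[symmetric]) (rule L.finite_trail, rule L.one_in_trail)
    finally show ?thesis using us zs by (simp add: vs_def)
  qed
  ultimately show ?case using us vs by (intro exI[of _ "us @ vs"]) auto
qed

lemma word_length_le_walk:
  assumes "set w \<subseteq> Z" "\<eta> \<in> lamps" "lit_within \<eta> (L.trail w)"
  shows "word_length W gens (\<eta>, word_val L w) \<le> length w + lamp_cost \<eta> w"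
  using word_of_walk[OF assms] word_length_le by metis

lemma ex_word:
  assumes "h \<in> carrier W"
  shows "\<exists>zs. set zs \<subseteq> gens \<and> word_val W zs = h \<and> length zs = word_length W gens h"
proof -
  obtain \<eta> x where h: "h = (\<eta>, x)" "\<eta> \<in> lamps" "x \<in> carrier L"
    using assms by (auto simp: carrier_wreath)
  obtain w where "set w \<subseteq> Z" "{i \<in> carrier L. \<eta> i \<noteq> \<one>\<^bsub>G\<^esub>} \<subseteq> L.trail w" "word_val L w = x"
    using L.ex_walk_covering[OF lamps_finite[OF h(2)] _ h(3)] by blast
  then obtain zs where "set zs \<subseteq> gens" "word_val W zs = h"
    using word_of_walk[of w \<eta>] h by (auto simp: lit_within_def)
  then show ?thesis using ex_shortest_word by metis
qed

lemma ex_shortest_walk: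
  assumes "(\<eta>, x) \<in> carrier W"
  shows "\<exists>w. set w \<subseteq> Z \<and> word_val L w = x \<and> lit_within \<eta> (L.trail w) \<and>
    length w + lamp_cost \<eta> w \<le> word_length W gens (\<eta>, x)"
  using ex_word[OF assms] walk_of_word by fastforce

lemma finite_ball: "finite {h \<in> carrier W. word_length W gens h \<le> n}"
proof (rule finite_subset)
  show "{h \<in> carrier W. word_length W gens h \<le> n} \<subseteq> word_val W ` {zs. set zs \<subseteq> gens \<and> length zs \<le> n}"
  proof
    fix h assume "h \<in> {h \<in> carrier W. word_length W gens h \<le> n}"
    then show "h \<in> word_val W ` {zs. set zs \<subseteq> gens \<and> length zs \<le> n}"
      using ex_word[of h] by auto
  qed
  show "finite (word_val W ` {zs. set zs \<subseteq> gens \<and> length zs \<le> n})"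
    using finite_lists_length_le[OF finite_gens] by auto
qed

end

section \<open>Conjugacy classes in the wreath product\<close>

context tree_lamplighter
begin

sublocale W: group W by (rule group_wreath)

text \<open>Elements whose lamps are spread over the orbits of \<open>\<langle>m\<rangle>\<close>, at most one to each orbit.\<close>

definition spread_out :: "(('l \<Rightarrow> 'g) \<times> 'l) set" where
  "spread_out = {(\<eta>, m). \<eta> \<in> lamps \<and> L.cyclically_reduced m \<and> lit_within \<eta> (L.fundamental_domain m)}"

lemma spread_out_closed: "spread_out \<subseteq> carrier W"
  by (auto simp: spread_out_def carrier_wreath L.cyclically_reduced_def)

lemma infinite_orbit_meets_unlit:
  assumes "\<phi> \<in> lamps" "inj (f :: nat \<Rightarrow> 'l)" "\<And>q. f q \<in> carrier L"
  shows "\<exists>q. \<phi> (f q) = \<one>\<^bsub>G\<^esub>"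
proof (rule ccontr)
  assume "\<nexists>q. \<phi> (f q) = \<one>\<^bsub>G\<^esub>"
  then have "range f \<subseteq> {i \<in> carrier L. \<phi> i \<noteq> \<one>\<^bsub>G\<^esub>}" using assms by auto
  then have "finite (range f)" using lamps_finite[OF assms(1)] finite_subset by blast
  then show False using assms(2) finite_imageD by blast
qed

text \<open>Comparing components, \<open>\<phi> i \<eta> i = \<eta>' i \<phi> (m\<inverse> i)\<close>. Off the fundamental domain this makes \<open>\<phi>\<close> constant
  along the orbits of \<open>\<langle>m\<rangle>\<close>, on either side of the point in the domain; these half-orbits are
  infinite and \<open>\<phi>\<close> has finite support, so \<open>\<phi>\<close> is trivial on both of them.\<close>

lemma spread_out_rigid:
  assumes "(\<eta>, m) \<in> spread_out" "(\<eta>', m) \<in> spread_out" "\<phi> \<in> lamps"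
    and conj: "(\<phi>, \<one>\<^bsub>L\<^esub>) \<otimes>\<^bsub>W\<^esub> (\<eta>, m) = (\<eta>', m) \<otimes>\<^bsub>W\<^esub> (\<phi>, \<one>\<^bsub>L\<^esub>)"
  shows "\<eta> = \<eta>'"
proof (rule lamps_eqI)
  show l: "\<eta> \<in> lamps" "\<eta>' \<in> lamps" using assms by (auto simp: spread_out_def)
  have m: "L.cyclically_reduced m" and lit: "lit_within \<eta> (L.fundamental_domain m)"
    "lit_within \<eta>' (L.fundamental_domain m)"
    using assms by (auto simp: spread_out_def)
  have mc: "m \<in> carrier L" using m by (simp add: L.cyclically_reduced_def)
  have eq: "\<phi> i \<otimes>\<^bsub>G\<^esub> \<eta> i = \<eta>' i \<otimes>\<^bsub>G\<^esub> \<phi> (inv\<^bsub>L\<^esub> m \<otimes>\<^bsub>L\<^esub> i)" if "i \<in> carrier L" for i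
    using fun_cong[OF arg_cong[OF conj, of fst], of i] that by (simp add: mult_wreath)
  have off: "\<phi> j = \<phi> (inv\<^bsub>L\<^esub> m \<otimes>\<^bsub>L\<^esub> j)" if "j \<in> carrier L" "j \<notin> L.fundamental_domain m" for j
  proof -
    have "\<eta> j = \<one>\<^bsub>G\<^esub>" "\<eta>' j = \<one>\<^bsub>G\<^esub>" using that lit by (auto simp: lit_within_def)
    then show ?thesis using eq[OF that(1)] that(1) mc lamps_closed[OF assms(3)] by simp
  qed
  fix i assume i: "i \<in> carrier L"
  show "\<eta> i = \<eta>' i"
  proof (cases "i \<in> L.fundamental_domain m")
    case False
    then show ?thesis using lit i by (auto simp: lit_within_def)
  next
    case True
    note inj = L.inj_power_orbit[OF m True]
    note const = L.constant_along_orbit[OF m True, of \<phi>, OF off]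
    obtain q :: nat where "\<phi> (m [^]\<^bsub>L\<^esub> q \<otimes>\<^bsub>L\<^esub> i) = \<one>\<^bsub>G\<^esub>"
      using infinite_orbit_meets_unlit[OF assms(3) inj(1)] mc i by auto
    then have 1: "\<phi> i = \<one>\<^bsub>G\<^esub>" using const(1) by simp
    have "inj (\<lambda>q::nat. inv\<^bsub>L\<^esub> (m [^]\<^bsub>L\<^esub> Suc q) \<otimes>\<^bsub>L\<^esub> i)"
      using inj_compose[OF inj(2) inj_Suc] by (simp add: o_def)
    then obtain q :: nat where "\<phi> (inv\<^bsub>L\<^esub> (m [^]\<^bsub>L\<^esub> Suc q) \<otimes>\<^bsub>L\<^esub> i) = \<one>\<^bsub>G\<^esub>"
      using infinite_orbit_meets_unlit[OF assms(3)] mc i by (metis L.inv_closed L.m_closed L.nat_pow_closed)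
    then have "\<phi> (inv\<^bsub>L\<^esub> m \<otimes>\<^bsub>L\<^esub> i) = \<one>\<^bsub>G\<^esub>" using const(2) by metis
    then show ?thesis using eq[OF i] 1 l i by (simp add: lamps_closed)
  qed
qed

lemma snd_mult_wreath: "snd (x \<otimes>\<^bsub>W\<^esub> y) = snd x \<otimes>\<^bsub>L\<^esub> snd y"
  by (cases x, cases y) (simp add: mult_wreath)

lemma snd_closed: "x \<in> carrier W \<Longrightarrow> snd x \<in> carrier L"
  by (auto simp: carrier_wreath)

lemma snd_inv_wreath: "x \<in> carrier W \<Longrightarrow> snd (inv\<^bsub>W\<^esub> x) = inv\<^bsub>L\<^esub> snd x"
  using snd_mult_wreath[of "inv\<^bsub>W\<^esub> x" x] snd_closed
  by (metis L.inv_equality W.inv_closed W.l_inv one_wreath snd_conv)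

text \<open>Among the conjugators to \<open>h\<close> take one whose \<open>L\<close>-component is shortest. Multiplication by \<open>h\<close> or \<open>h\<inverse>\<close>
  gives further conjugators, so this component is one of the words in \<open>K\<close>. It determines the
  conjugated element by rigidity.\<close>

lemma spread_out_conjugates:
  assumes h: "h \<in> spread_out"
  defines "F \<equiv> {a \<in> spread_out. \<exists>z\<in>carrier W. z \<otimes>\<^bsub>W\<^esub> a = h \<otimes>\<^bsub>W\<^esub> z}"
  shows "finite F \<and> card F \<le> 2 * (length (L.nf (snd h)) + 1)"
proof -
  define m where "m = snd h"
  define K where "K = (\<lambda>k. take k (L.nf m)) ` {..length (L.nf m)} \<union>
    (\<lambda>k. take k (L.nf (inv\<^bsub>L\<^esub> m))) ` {..length (L.nf m)}"
  have hc: "h \<in> carrier W" using h spread_out_closed by auto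
  have mr: "L.cyclically_reduced m" using h by (auto simp: spread_out_def m_def)
  have "card K \<le> card ((\<lambda>k. take k (L.nf m)) ` {..length (L.nf m)}) +
      card ((\<lambda>k. take k (L.nf (inv\<^bsub>L\<^esub> m))) ` {..length (L.nf m)})"
    unfolding K_def by (rule card_Un_le)
  also have "\<dots> \<le> (length (L.nf m) + 1) + (length (L.nf m) + 1)"
    by (intro add_mono order.trans[OF card_image_le]) auto
  finally have cardK: "card K \<le> 2 * (length (L.nf m) + 1)" by simp
  have finK: "finite K" by (simp add: K_def)
  have "\<exists>z. z \<in> carrier W \<and> z \<otimes>\<^bsub>W\<^esub> a = h \<otimes>\<^bsub>W\<^esub> z \<and> L.nf (snd z) \<in> K" if a: "a \<in> F" for a
  proof -
    let ?P = "\<lambda>z. z \<in> carrier W \<and> z \<otimes>\<^bsub>W\<^esub> a = h \<otimes>\<^bsub>W\<^esub> z"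
    have ac: "a \<in> carrier W" using a spread_out_closed by (auto simp: F_def)
    have "\<exists>z. ?P z" using a by (auto simp: F_def)
    then obtain z where z: "?P z" and min: "\<And>z'. ?P z' \<Longrightarrow> length (L.nf (snd z)) \<le> length (L.nf (snd z'))"
      using ex_has_least_nat[of ?P _ "\<lambda>z. length (L.nf (snd z))"] by blast
    have "?P (h \<otimes>\<^bsub>W\<^esub> z)" using z ac hc by (simp add: W.m_assoc)
    moreover have "?P (inv\<^bsub>W\<^esub> h \<otimes>\<^bsub>W\<^esub> z)"
    proof -
      have "inv\<^bsub>W\<^esub> h \<otimes>\<^bsub>W\<^esub> z \<otimes>\<^bsub>W\<^esub> a = inv\<^bsub>W\<^esub> h \<otimes>\<^bsub>W\<^esub> (h \<otimes>\<^bsub>W\<^esub> z)"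
        using z ac hc by (simp add: W.m_assoc)
      also have "\<dots> = h \<otimes>\<^bsub>W\<^esub> (inv\<^bsub>W\<^esub> h \<otimes>\<^bsub>W\<^esub> z)"
        using z hc by (simp flip: W.m_assoc)
      finally show ?thesis using z hc by simp
    qed
    ultimately have short: "length (L.nf (snd z)) \<le> length (L.nf (m \<otimes>\<^bsub>L\<^esub> snd z))"
      "length (L.nf (snd z)) \<le> length (L.nf (inv\<^bsub>L\<^esub> m \<otimes>\<^bsub>L\<^esub> snd z))"
      using min hc by (metis snd_mult_wreath snd_inv_wreath m_def)+
    have "m \<otimes>\<^bsub>L\<^esub> snd z = snd z \<otimes>\<^bsub>L\<^esub> snd a" using z by (metis snd_mult_wreath m_def)
    moreover have "L.cyclically_reduced (snd a)" using a by (auto simp: F_def spread_out_def)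
    ultimately obtain k where "k \<le> length (L.nf m)"
      "L.nf (snd z) = take k (L.nf m) \<or> L.nf (snd z) = take k (L.nf (inv\<^bsub>L\<^esub> m))"
      using L.nf_conjugator[OF mr _ _ _ short] z snd_closed by blast
    then have "L.nf (snd z) \<in> K"
      unfolding K_def by (metis UnI1 UnI2 atMost_iff image_eqI)
    then show ?thesis using z by blast
  qed
  then obtain z where z: "\<And>a. a \<in> F \<Longrightarrow> z a \<in> carrier W \<and> z a \<otimes>\<^bsub>W\<^esub> a = h \<otimes>\<^bsub>W\<^esub> z a \<and> L.nf (snd (z a)) \<in> K"
    by metis
  have inj: "inj_on (\<lambda>a. L.nf (snd (z a))) F"
  proof (rule inj_onI)
    fix a b assume ab: "a \<in> F" "b \<in> F" "L.nf (snd (z a)) = L.nf (snd (z b))"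
    have c: "a \<in> carrier W" "b \<in> carrier W" using ab spread_out_closed by (auto simp: F_def)
    note za = z[OF ab(1)] and zb = z[OF ab(2)]
    have same: "snd (z a) = snd (z b)" using ab(3) za zb snd_closed by (simp add: L.nf_inject)
    define y where "y = inv\<^bsub>W\<^esub> z b \<otimes>\<^bsub>W\<^esub> z a"
    have yc: "y \<in> carrier W" using za zb by (simp add: y_def)
    have "y \<otimes>\<^bsub>W\<^esub> a = inv\<^bsub>W\<^esub> z b \<otimes>\<^bsub>W\<^esub> (h \<otimes>\<^bsub>W\<^esub> z a)"
      using za zb c by (simp add: y_def W.m_assoc)
    also have "h \<otimes>\<^bsub>W\<^esub> z a = z b \<otimes>\<^bsub>W\<^esub> b \<otimes>\<^bsub>W\<^esub> y"
    proof -
      have "z b \<otimes>\<^bsub>W\<^esub> b \<otimes>\<^bsub>W\<^esub> y = h \<otimes>\<^bsub>W\<^esub> z b \<otimes>\<^bsub>W\<^esub> y" using zb by simp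
      then show ?thesis
        using conjunct1[OF za] conjunct1[OF zb] hc by (simp add: y_def W.m_assoc W.inv_cancel_left)
    qed
    also have "inv\<^bsub>W\<^esub> z b \<otimes>\<^bsub>W\<^esub> \<dots> = b \<otimes>\<^bsub>W\<^esub> y"
      using conjunct1[OF zb] c yc by (simp add: W.m_assoc W.inv_cancel_left)
    finally have conj: "y \<otimes>\<^bsub>W\<^esub> a = b \<otimes>\<^bsub>W\<^esub> y" .
    have sy: "snd y = \<one>\<^bsub>L\<^esub>"
      using same za zb snd_closed by (simp add: y_def snd_mult_wreath snd_inv_wreath)
    have "snd a = snd b"
      using arg_cong[OF conj, of snd] sy c snd_closed by (simp add: snd_mult_wreath)
    then obtain \<eta> \<eta>' m' \<phi> where e: "a = (\<eta>, m')" "b = (\<eta>', m')" "y = (\<phi>, \<one>\<^bsub>L\<^esub>)"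
      using sy by (metis prod.collapse)
    then show "a = b"
      using spread_out_rigid[of \<eta> m' \<eta>' \<phi>] ab yc conj by (auto simp: F_def carrier_wreath)
  qed
  have "(\<lambda>a. L.nf (snd (z a))) ` F \<subseteq> K" using z by blast
  then show ?thesis
    using inj finK cardK card_inj_on_le[OF inj _ finK] inj_on_finite[OF inj _ finK]
    by (auto simp: m_def)
qed

text \<open>This is the passage from elements to classes. The numbers \<open>j\<close> and \<open>k\<close> are the positions on the word
  \<open>m\<close> of the original ends of the walk, that is of \<open>c\<close> and \<open>c x\<close> after the translation by \<open>c\<close>.\<close>

lemma spread_out_placement:
  assumes inf: "infinite (carrier L)" and h: "(\<eta>, x) \<in> carrier W" "word_length W gens (\<eta>, x) = n"
  shows "\<exists>\<eta>' m j k. (\<eta>', m) \<in> spread_out \<and> word_length W gens (\<eta>', m) \<le> n + 2 \<and>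
    length (L.nf m) \<le> n + 2 \<and> j \<le> n + 2 \<and> k \<le> n + 2 \<and>
    \<eta> = wreath_shift L (inv\<^bsub>L\<^esub> word_val L (take j (L.nf m))) \<eta>' \<and>
    x = inv\<^bsub>L\<^esub> word_val L (take j (L.nf m)) \<otimes>\<^bsub>L\<^esub> word_val L (take k (L.nf m))"
proof -
  have hc: "\<eta> \<in> lamps" "x \<in> carrier L" using h by (auto simp: carrier_wreath)
  obtain w where w: "set w \<subseteq> Z" "word_val L w = x" "lit_within \<eta> (L.trail w)"
    "length w + lamp_cost \<eta> w \<le> n"
    using ex_shortest_walk[OF h(1)] h(2) by auto
  have wc: "set w \<subseteq> carrier L" using w L.Z_word_closed by blast
  obtain w' c r where *: "set w' \<subseteq> Z \<and> c \<in> carrier L \<and> length w' \<le> length w \<and>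
    L.trail w' = (\<otimes>\<^bsub>L\<^esub>) c ` L.trail w \<and> L.nf (c \<otimes>\<^bsub>L\<^esub> word_val L w) = L.nf c @ L.nf (word_val L w) \<and>
    L.nf (word_val L w') = L.nf c @ L.nf (word_val L w) @ r \<and>
    (word_val L w' = \<one>\<^bsub>L\<^esub> \<longrightarrow> L.trail w' = {\<one>\<^bsub>L\<^esub>}) \<and>
    (\<forall>y\<in>L.trail w'. (y = \<one>\<^bsub>L\<^esub> \<or> L.starts (hd (L.nf (word_val L w'))) y) \<and>
       (y = word_val L w' \<or>
        L.starts (inv\<^bsub>L\<^esub> last (L.nf (word_val L w'))) (inv\<^bsub>L\<^esub> word_val L w' \<otimes>\<^bsub>L\<^esub> y)))"
    using L.walk_between_leaves[OF w(1)] by (elim exE)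
  then have w': "set w' \<subseteq> Z" "c \<in> carrier L" "length w' \<le> length w"
    "L.trail w' = (\<otimes>\<^bsub>L\<^esub>) c ` L.trail w" "L.nf (c \<otimes>\<^bsub>L\<^esub> x) = L.nf c @ L.nf x"
    "L.nf (word_val L w') = L.nf c @ L.nf x @ r"
    unfolding w(2) by blast+
  have leaves: "word_val L w' = \<one>\<^bsub>L\<^esub> \<Longrightarrow> L.trail w' = {\<one>\<^bsub>L\<^esub>}"
    "\<And>y. y \<in> L.trail w' \<Longrightarrow> y = \<one>\<^bsub>L\<^esub> \<or> L.starts (hd (L.nf (word_val L w'))) y"
    "\<And>y. y \<in> L.trail w' \<Longrightarrow> y = word_val L w' \<or>
       L.starts (inv\<^bsub>L\<^esub> last (L.nf (word_val L w'))) (inv\<^bsub>L\<^esub> word_val L w' \<otimes>\<^bsub>L\<^esub> y)"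
    using * by blast+
  have w'c: "set w' \<subseteq> carrier L" using w' L.Z_word_closed by blast
  define v where "v = word_val L w'"
  have v: "v \<in> carrier L" using w'c by (simp add: v_def)
  obtain t where t: "t \<noteq> []" "length t \<le> 2" "L.nf v @ t \<in> L.normal_words"
    "hd (L.nf v @ t) \<noteq> inv\<^bsub>L\<^esub> last t"
    using L.ex_cyclic_extension[OF inf L.nf_normal[OF v]] by blast
  define m where "m = word_val L (L.nf v @ t)"
  have tZ: "set t \<subseteq> Z" "set t \<subseteq> carrier L"
    using t L.normal_words_closed L.Z_word_closed by (auto simp: L.normal_words_append L.normal_words_def)
  have nfm: "L.nf m = L.nf v @ t" using t by (simp add: m_def L.nf_val)
  have mc: "m \<in> carrier L" using L.normal_words_closed[OF t(3)] by (simp add: m_def)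
  have mcyc: "L.cyclically_reduced m" using t nfm mc by (auto simp: L.cyclically_reduced_def)
  have mv: "m = word_val L (w' @ t)"
    using v tZ w'c L.nf_letters_closed[OF v] by (simp add: m_def L.word_val_append v_def)
  define \<eta>' where "\<eta>' = wreath_shift L c \<eta>"
  have \<eta>': "\<eta>' \<in> lamps" using hc w' by (simp add: \<eta>'_def shift_lamps)
  have lit': "lit_within \<eta>' (L.trail w')"
    unfolding lit_within_def
  proof (intro ballI impI)
    fix i assume i: "i \<in> carrier L" "\<eta>' i \<noteq> \<one>\<^bsub>G\<^esub>"
    then have "inv\<^bsub>L\<^esub> c \<otimes>\<^bsub>L\<^esub> i \<in> L.trail w"
      using w(3) w'(2) by (simp add: lit_within_def \<eta>'_def wreath_shift_def)
    moreover have "i = c \<otimes>\<^bsub>L\<^esub> (inv\<^bsub>L\<^esub> c \<otimes>\<^bsub>L\<^esub> i)" using i w'(2) by (simp flip: L.m_assoc)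
    ultimately show "i \<in> L.trail w'" using w'(4) by blast
  qed
  have trail_mono: "L.trail w' \<subseteq> L.trail (w' @ t)"
    using w'c tZ by (simp add: L.trail_append)
  have "L.trail w' \<subseteq> L.fundamental_domain m"
    by (rule L.leaf_tree_subset_fundamental_domain[OF v mcyc nfm t(1) L.trail_closed[OF w'c]])
      (use leaves in \<open>simp_all only: v_def\<close>)
  then have so: "(\<eta>', m) \<in> spread_out"
    using \<eta>' mcyc lit' by (auto simp: spread_out_def lit_within_def)
  \<comment> \<open>The vertices that only the appended word \<open>t\<close> visits are unlit.\<close>
  have cost: "lamp_cost \<eta>' (w' @ t) = lamp_cost \<eta> w"
  proof -
    have "lamp_cost \<eta>' (w' @ t) = lamp_cost \<eta>' w'"
    proof (rule sum.mono_neutral_right[OF L.finite_trail trail_mono], rule ballI)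
      fix i assume i: "i \<in> L.trail (w' @ t) - L.trail w'"
      then have "i \<in> carrier L" using L.trail_closed[of "w' @ t"] w'c tZ(2) by auto
      then have "\<eta>' i = \<one>\<^bsub>G\<^esub>" using lit' i by (auto simp: lit_within_def)
      then show "word_length G Y (\<eta>' i) = 0" by simp
    qed
    also have "\<dots> = (\<Sum>i\<in>L.trail w. word_length G Y (\<eta>' (c \<otimes>\<^bsub>L\<^esub> i)))"
      unfolding w'(4)
      by (rule sum.reindex_cong[OF L.inj_on_translation[OF w'(2) L.trail_closed[OF wc]] HOL.refl HOL.refl])
    also have "\<dots> = lamp_cost \<eta> w"
    proof (rule sum.cong[OF HOL.refl])
      fix i assume "i \<in> L.trail w"
      then have "i \<in> carrier L" using L.trail_closed[OF wc] by auto
      then show "word_length G Y (\<eta>' (c \<otimes>\<^bsub>L\<^esub> i)) = word_length G Y (\<eta> i)"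
        using w'(2) by (simp add: \<eta>'_def wreath_shift_def flip: L.m_assoc)
    qed
    finally show ?thesis .
  qed
  have "lit_within \<eta>' (L.trail (w' @ t))" using lit' trail_mono by (auto simp: lit_within_def)
  then have "word_length W gens (\<eta>', m) \<le> length (w' @ t) + lamp_cost \<eta>' (w' @ t)"
    unfolding mv using w'(1) tZ \<eta>' by (intro word_length_le_walk) auto
  then have len: "word_length W gens (\<eta>', m) \<le> n + 2"
    using cost w(4) w'(3) t(2) by simp
  have lnv: "length (L.nf v) \<le> n"
    using L.length_nf_val[OF w'(1)] w'(3) w(4) by (simp add: v_def)
  define j k where "j = length (L.nf c)" and "k = length (L.nf c) + length (L.nf x)"
  have nfm': "L.nf m = L.nf c @ L.nf x @ r @ t" using nfm w'(6) by (simp add: v_def)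
  have cj: "word_val L (take j (L.nf m)) = c" using nfm' w'(2) by (simp add: j_def)
  have "take k (L.nf m) = L.nf (c \<otimes>\<^bsub>L\<^esub> x)" using nfm' w'(5) by (simp add: k_def)
  then have ck: "word_val L (take k (L.nf m)) = c \<otimes>\<^bsub>L\<^esub> x" using w'(2) hc by simp
  have "\<eta> = wreath_shift L (inv\<^bsub>L\<^esub> c) \<eta>'"
    using hc w'(2) \<eta>'
    by (intro lamps_eqI) (auto simp: shift_lamps, auto simp: \<eta>'_def wreath_shift_def simp flip: L.m_assoc)
  moreover have "x = inv\<^bsub>L\<^esub> c \<otimes>\<^bsub>L\<^esub> (c \<otimes>\<^bsub>L\<^esub> x)" using hc w'(2) by (simp flip: L.m_assoc)
  moreover have "j \<le> n + 2" "k \<le> n + 2" "length (L.nf m) \<le> n + 2"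
    using lnv w'(6) nfm t(2) by (auto simp: j_def k_def v_def)
  ultimately show ?thesis
    using so len cj ck by (intro exI[of _ \<eta>'] exI[of _ m] exI[of _ j] exI[of _ k]) simp
qed

abbreviation sphere where "sphere n \<equiv> {h \<in> carrier W. word_length W gens h = n}"

abbreviation class_sphere where
  "class_sphere n \<equiv> {C \<in> conjugacy_classes W. class_length W gens C = n}"

lemma finite_sphere: "finite (sphere n)"
  by (rule finite_subset[OF _ finite_ball[of n]]) auto

lemma conjugacy_class_self: "h \<in> carrier W \<Longrightarrow> h \<in> conjugacy_class W h"
  unfolding conjugacy_class_def by (intro CollectI exI[of _ "\<one>\<^bsub>W\<^esub>"]) simp

lemma conjugacy_class_closed: "h \<in> carrier W \<Longrightarrow> conjugacy_class W h \<subseteq> carrier W"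
  by (auto simp: conjugacy_class_def)

lemma conjugate_in_class:
  assumes "h \<in> carrier W" "a \<in> conjugacy_class W h" "b \<in> conjugacy_class W h"
  shows "\<exists>z\<in>carrier W. z \<otimes>\<^bsub>W\<^esub> a = b \<otimes>\<^bsub>W\<^esub> z"
proof -
  obtain x y where xy: "x \<in> carrier W" "a = x \<otimes>\<^bsub>W\<^esub> h \<otimes>\<^bsub>W\<^esub> inv\<^bsub>W\<^esub> x"
    "y \<in> carrier W" "b = y \<otimes>\<^bsub>W\<^esub> h \<otimes>\<^bsub>W\<^esub> inv\<^bsub>W\<^esub> y"
    using assms by (auto simp: conjugacy_class_def)
  have "y \<otimes>\<^bsub>W\<^esub> inv\<^bsub>W\<^esub> x \<otimes>\<^bsub>W\<^esub> a = b \<otimes>\<^bsub>W\<^esub> (y \<otimes>\<^bsub>W\<^esub> inv\<^bsub>W\<^esub> x)"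
    unfolding xy(2,4) using xy(1,3) assms(1) by (simp add: W.m_assoc W.inv_cancel_left)
  then show ?thesis using xy by (intro bexI[of _ "y \<otimes>\<^bsub>W\<^esub> inv\<^bsub>W\<^esub> x"]) auto
qed

lemma conjugacy_class_eq:
  assumes "h \<in> carrier W" "a \<in> conjugacy_class W h"
  shows "conjugacy_class W a = conjugacy_class W h"
proof -
  have sub: "conjugacy_class W b \<subseteq> conjugacy_class W g"
    if g: "g \<in> carrier W" "b \<in> carrier W" "z \<in> carrier W" "z \<otimes>\<^bsub>W\<^esub> b = g \<otimes>\<^bsub>W\<^esub> z" for b g z
  proof
    fix c assume "c \<in> conjugacy_class W b"
    then obtain x where x: "x \<in> carrier W" "c = x \<otimes>\<^bsub>W\<^esub> b \<otimes>\<^bsub>W\<^esub> inv\<^bsub>W\<^esub> x"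
      by (auto simp: conjugacy_class_def)
    have "b = inv\<^bsub>W\<^esub> z \<otimes>\<^bsub>W\<^esub> (z \<otimes>\<^bsub>W\<^esub> b)" using g(2,3) by (simp flip: W.m_assoc)
    then have "b = inv\<^bsub>W\<^esub> z \<otimes>\<^bsub>W\<^esub> (g \<otimes>\<^bsub>W\<^esub> z)" using g(4) by simp
    then have "c = (x \<otimes>\<^bsub>W\<^esub> inv\<^bsub>W\<^esub> z) \<otimes>\<^bsub>W\<^esub> g \<otimes>\<^bsub>W\<^esub> inv\<^bsub>W\<^esub> (x \<otimes>\<^bsub>W\<^esub> inv\<^bsub>W\<^esub> z)"
      using x g(1,3) by (simp add: W.inv_mult_group W.m_assoc)
    then show "c \<in> conjugacy_class W g"
      unfolding conjugacy_class_def
      by (intro CollectI exI[of _ "x \<otimes>\<^bsub>W\<^esub> inv\<^bsub>W\<^esub> z"]) (use x g(1,3) in simp)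
  qed
  have ac: "a \<in> carrier W" using conjugacy_class_closed[OF assms(1)] assms(2) by (rule subsetD)
  obtain z where z: "z \<in> carrier W" "z \<otimes>\<^bsub>W\<^esub> a = h \<otimes>\<^bsub>W\<^esub> z"
    using conjugate_in_class[OF assms(1,2) conjugacy_class_self[OF assms(1)]] by blast
  obtain z' where z': "z' \<in> carrier W" "z' \<otimes>\<^bsub>W\<^esub> h = a \<otimes>\<^bsub>W\<^esub> z'"
    using conjugate_in_class[OF assms(1) conjugacy_class_self[OF assms(1)] assms(2)] by blast
  show ?thesis using sub[OF assms(1) ac z] sub[OF ac assms(1) z'] by blast
qed

lemma class_sphere_subset: "class_sphere n \<subseteq> conjugacy_class W ` sphere n"
proof
  fix C assume C: "C \<in> class_sphere n"
  then obtain h where h: "h \<in> carrier W" "C = conjugacy_class W h"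
    by (auto simp: conjugacy_classes_def)
  have "h \<in> C" unfolding h(2) by (rule conjugacy_class_self[OF h(1)])
  then have "word_length W gens ` C \<noteq> {}" by (simp only: image_is_empty) (rule notI, simp)
  then have "class_length W gens C \<in> word_length W gens ` C"
    unfolding class_length_def by (rule Inf_nat_def1)
  then have "n \<in> word_length W gens ` C" using C by simp
  then obtain a where a: "a \<in> C" "word_length W gens a = n" by (elim imageE) simp
  have "a \<in> carrier W" using a(1) conjugacy_class_closed[OF h(1)] h(2) by blast
  then have "a \<in> sphere n" using a(2) by simp
  moreover have "C = conjugacy_class W a"
    using a(1) unfolding h(2) by (rule conjugacy_class_eq[OF h(1), symmetric])
  ultimately show "C \<in> conjugacy_class W ` sphere n" by (rule rev_image_eqI)
qed

lemma finite_class_sphere: "finite (class_sphere n)"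
  by (rule finite_subset[OF class_sphere_subset finite_imageI[OF finite_sphere]])

lemma card_class_sphere_le: "card (class_sphere n) \<le> card (sphere n)"
  by (rule surj_card_le[OF finite_sphere class_sphere_subset])

lemma class_length_le:
  assumes "h \<in> carrier W"
  shows "class_length W gens (conjugacy_class W h) \<le> word_length W gens h"
  unfolding class_length_def by (rule cINF_lower[OF _ conjugacy_class_self[OF assms]]) simp

lemma finite_spread_out_Int_class:
  assumes "C \<in> conjugacy_classes W"
  shows "finite (spread_out \<inter> C)"
    and "a \<in> spread_out \<inter> C \<Longrightarrow> card (spread_out \<inter> C) \<le> 2 * (length (L.nf (snd a)) + 1)"
proof -
  obtain h where h: "h \<in> carrier W" "C = conjugacy_class W h"
    using assms by (auto simp: conjugacy_classes_def)
  have *: "finite (spread_out \<inter> C) \<and> card (spread_out \<inter> C) \<le> 2 * (length (L.nf (snd a)) + 1)"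
    if a: "a \<in> spread_out \<inter> C" for a
  proof -
    have "spread_out \<inter> C \<subseteq> {b \<in> spread_out. \<exists>z\<in>carrier W. z \<otimes>\<^bsub>W\<^esub> b = a \<otimes>\<^bsub>W\<^esub> z}"
      using conjugate_in_class[OF h(1)] a h(2) by blast
    then show ?thesis
      using spread_out_conjugates[of a] a by (meson IntD1 card_mono finite_subset le_trans)
  qed
  show "finite (spread_out \<inter> C)"
  proof (cases "spread_out \<inter> C = {}")
    case False
    then obtain a where "a \<in> spread_out \<inter> C" by (rule exE[OF iffD2[OF ex_in_conv]])
    then show ?thesis by (rule conjunct1[OF *])
  qed simp
  show "a \<in> spread_out \<inter> C \<Longrightarrow> card (spread_out \<inter> C) \<le> 2 * (length (L.nf (snd a)) + 1)"
    by (rule conjunct2[OF *])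
qed

text \<open>There are at most \<open>(n + 3)\<^sup>2\<close> pairs of positions, and at most \<open>2 (n + 3)\<close> spread out elements with
  \<open>\<bar>m\<bar> \<le> n + 2\<close> in each class.\<close>

lemma card_sphere_le:
  assumes inf: "infinite (carrier L)"
  shows "card (sphere n) \<le> 2 * (n + 3) ^ 3 * (\<Sum>j\<le>n + 2. card (class_sphere j))"
proof -
  define B where "B = {a \<in> spread_out. word_length W gens a \<le> n + 2 \<and> length (L.nf (snd a)) \<le> n + 2}"
  define K where "K = (\<Union>j\<le>n + 2. class_sphere j)"
  define F where "F = (\<lambda>(a :: ('l \<Rightarrow> 'g) \<times> 'l, j, k). (wreath_shift L (inv\<^bsub>L\<^esub> word_val L (take j (L.nf (snd a)))) (fst a),
    inv\<^bsub>L\<^esub> word_val L (take j (L.nf (snd a))) \<otimes>\<^bsub>L\<^esub> word_val L (take k (L.nf (snd a)))))"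
  have finB: "finite B"
    by (rule finite_subset[OF _ finite_ball[of "n + 2"]]) (use spread_out_closed in \<open>auto simp: B_def\<close>)
  have "sphere n \<subseteq> F ` (B \<times> {..n + 2} \<times> {..n + 2})"
  proof
    fix h assume h: "h \<in> sphere n"
    obtain \<eta> x where hx: "h = (\<eta>, x)" by fastforce
    obtain \<eta>' m j k where p: "(\<eta>', m) \<in> spread_out" "word_length W gens (\<eta>', m) \<le> n + 2"
      "length (L.nf m) \<le> n + 2" "j \<le> n + 2" "k \<le> n + 2"
      "\<eta> = wreath_shift L (inv\<^bsub>L\<^esub> word_val L (take j (L.nf m))) \<eta>'"
      "x = inv\<^bsub>L\<^esub> word_val L (take j (L.nf m)) \<otimes>\<^bsub>L\<^esub> word_val L (take k (L.nf m))"
      using spread_out_placement[OF inf, of \<eta> x n] h hx by blast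
    then have "h = F ((\<eta>', m), j, k)" "((\<eta>', m), j, k) \<in> B \<times> {..n + 2} \<times> {..n + 2}"
      by (simp_all add: F_def B_def hx)
    then show "h \<in> F ` (B \<times> {..n + 2} \<times> {..n + 2})" by blast
  qed
  then have "card (sphere n) \<le> card (B \<times> {..n + 2} \<times> {..n + 2})"
    using finB by (intro surj_card_le) auto
  also have "\<dots> = card B * (n + 3) ^ 2"
    by (simp add: card_cartesian_product power2_eq_square algebra_simps)
  also have "card B \<le> card K * (2 * (n + 3))"
  proof -
    have "B \<subseteq> (\<Union>C\<in>K. B \<inter> C)"
    proof
      fix a assume a: "a \<in> B"
      then have ac: "a \<in> carrier W" "word_length W gens a \<le> n + 2"
        using spread_out_closed by (auto simp: B_def)
      then have "conjugacy_class W a \<in> K"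
        using class_length_le[OF ac(1)] by (auto simp: K_def conjugacy_classes_def)
      then show "a \<in> (\<Union>C\<in>K. B \<inter> C)" using a conjugacy_class_self[OF ac(1)] by blast
    qed
    then have "card B \<le> card (\<Union>C\<in>K. B \<inter> C)" using finB by (intro card_mono) (auto simp: finite_class_sphere K_def)
    also have "\<dots> \<le> (\<Sum>C\<in>K. card (B \<inter> C))"
      by (rule card_UN_le) (auto simp: K_def finite_class_sphere)
    also have "\<dots> \<le> (\<Sum>C\<in>K. 2 * (n + 3))"
    proof (rule sum_mono)
      fix C assume "C \<in> K"
      then have C: "C \<in> conjugacy_classes W" by (auto simp: K_def)
      show "card (B \<inter> C) \<le> 2 * (n + 3)"
      proof (cases "B \<inter> C = {}")
        case False
        then obtain a where a: "a \<in> B" "a \<in> C" by blast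
        have "card (B \<inter> C) \<le> card (spread_out \<inter> C)"
          using finite_spread_out_Int_class(1)[OF C] by (intro card_mono) (auto simp: B_def)
        also have "\<dots> \<le> 2 * (length (L.nf (snd a)) + 1)"
          using finite_spread_out_Int_class(2)[OF C] a by (auto simp: B_def)
        also have "\<dots> \<le> 2 * (n + 3)" using a by (auto simp: B_def)
        finally show ?thesis .
      qed simp
    qed
    finally show ?thesis by simp
  qed
  also have "card K \<le> (\<Sum>j\<le>n + 2. card (class_sphere j))"
    unfolding K_def by (rule card_UN_le) simp
  finally have "card (sphere n) \<le> (\<Sum>j\<le>n + 2. card (class_sphere j)) * (2 * (n + 3)) * (n + 3) ^ 2"
    by (simp add: mult_right_mono)
  then show ?thesis by (simp add: power3_eq_cube power2_eq_square algebra_simps)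
qed

text \<open>Otherwise there would be only finitely many classes; but the elements with all lamps off and
  cyclically reduced \<open>L\<close>-component are infinitely many, and each class contains finitely many of them.\<close>

lemma infinite_nonempty_class_spheres:
  assumes inf: "infinite (carrier L)"
  shows "infinite {n. card (class_sphere n) \<noteq> 0}"
proof
  assume fin: "finite {n. card (class_sphere n) \<noteq> 0}"
  define F where "F = (\<lambda>m. (\<lambda>i\<in>carrier L. \<one>\<^bsub>G\<^esub>, m)) ` {m. L.cyclically_reduced m}"
  have Fs: "F \<subseteq> spread_out"
    by (auto simp: F_def spread_out_def one_lamps lit_within_def)
  have "conjugacy_classes W \<subseteq> (\<Union>n\<in>{n. card (class_sphere n) \<noteq> 0}. class_sphere n)"
  proof
    fix C assume "C \<in> conjugacy_classes W"
    then have C: "C \<in> class_sphere (class_length W gens C)" by simp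
    then have "card (class_sphere (class_length W gens C)) \<noteq> 0"
      using finite_class_sphere card_0_eq by blast
    then show "C \<in> (\<Union>n\<in>{n. card (class_sphere n) \<noteq> 0}. class_sphere n)" using C by blast
  qed
  then have finC: "finite (conjugacy_classes W)"
    by (rule finite_subset) (use fin finite_class_sphere in auto)
  have "F \<subseteq> (\<Union>C\<in>conjugacy_classes W. spread_out \<inter> C)"
  proof
    fix a assume a: "a \<in> F"
    then have "a \<in> carrier W" using Fs spread_out_closed by blast
    then have "conjugacy_class W a \<in> conjugacy_classes W" "a \<in> conjugacy_class W a"
      by (simp_all add: conjugacy_classes_def conjugacy_class_self)
    then show "a \<in> (\<Union>C\<in>conjugacy_classes W. spread_out \<inter> C)" using a Fs by blast
  qed
  moreover have "finite (\<Union>C\<in>conjugacy_classes W. spread_out \<inter> C)"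
    using finC finite_spread_out_Int_class(1) by blast
  ultimately have "finite F" by (rule finite_subset)
  moreover have "inj_on (\<lambda>m. (\<lambda>i\<in>carrier L. \<one>\<^bsub>G\<^esub>, m)) {m. L.cyclically_reduced m}"
    by (rule inj_onI) simp
  ultimately have "finite {m. L.cyclically_reduced m}" unfolding F_def by (rule finite_imageD)
  then show False using L.infinite_cyclically_reduced[OF inf] by blast
qed

end

section \<open>Comparing radii of convergence\<close>

lemma conv_radius_antimono_nat:
  fixes c d :: "nat \<Rightarrow> nat"
  assumes "\<And>n. d n \<le> c n"
  shows "conv_radius (\<lambda>n. of_nat (c n) :: complex) \<le> conv_radius (\<lambda>n. of_nat (d n) :: complex)"
  unfolding conv_radius_def
proof (intro ereal_inverse_antimono Limsup_mono always_eventually allI)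
  show "0 \<le> limsup (\<lambda>n. ereal (root n (norm (of_nat (d n) :: complex))))"
    by (intro le_Limsup always_eventually) (auto intro: real_root_ge_zero)
  show "ereal (root n (norm (of_nat (d n) :: complex))) \<le> ereal (root n (norm (of_nat (c n) :: complex)))" for n
    using assms[of n] by (cases "n = 0") auto
qed

text \<open>Infinitely many coefficients are at least \<open>1\<close>, so the terms of the series at \<open>1\<close> do not tend to \<open>0\<close>.\<close>

lemma conv_radius_le_one:
  fixes d :: "nat \<Rightarrow> nat"
  assumes "infinite {n. d n \<noteq> 0}"
  shows "conv_radius (\<lambda>n. of_nat (d n) :: complex) \<le> 1"
proof (rule ccontr)
  assume "\<not> ?thesis"
  then have "summable (\<lambda>n. of_nat (d n) * (1 :: complex) ^ n)"
    by (intro summable_in_conv_radius) (simp add: one_ereal_def)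
  then have "(\<lambda>n. of_nat (d n) :: complex) \<longlonglongrightarrow> 0"
    using summable_LIMSEQ_zero by fastforce
  then have "eventually (\<lambda>n. norm (of_nat (d n) :: complex) < 1) sequentially"
    by (auto simp: tendsto_iff dist_norm dest: spec[of _ 1])
  then have "eventually (\<lambda>n. d n = 0) sequentially"
    by (rule eventually_mono) simp
  then have "finite {n. d n \<noteq> 0}"
    by (simp add: eventually_cofinite flip: cofinite_eq_sequentially)
  then show False using assms by simp
qed

text \<open>For the induction step write \<open>x = z\<^sup>2\<close>: the factor \<open>(n + a) z\<^sup>n\<close> is bounded.\<close>

lemma summable_polynomial_times_geometric:
  fixes x :: real
  assumes "0 < x" "x < 1"
  shows "summable (\<lambda>n. real (n + a) ^ p * x ^ n)"
  using assms
proof (induction p arbitrary: x)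
  case 0
  then show ?case by (simp add: summable_geometric)
next
  case (Suc p)
  define z where "z = sqrt x"
  have z: "0 < z" "z < 1" "z * z = x" using Suc.prems by (auto simp: z_def)
  have "(\<lambda>n. real n * z ^ n + real a * z ^ n) \<longlonglongrightarrow> 0 + real a * 0"
    using z by (intro tendsto_intros powser_times_n_limit_0 LIMSEQ_realpow_zero) auto
  then have "Bseq (\<lambda>n. real (n + a) * z ^ n)"
    by (intro convergent_imp_Bseq convergentI) (simp add: algebra_simps)
  then obtain K where "\<forall>n. norm (real (n + a) * z ^ n) \<le> K" by (rule BseqE)
  then have K: "norm (real (n + a) * z ^ n) \<le> K" for n ..
  have "summable (\<lambda>n. K * (real (n + a) ^ p * z ^ n))"
    using Suc.IH[OF z(1,2)] by (rule summable_mult)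
  then show ?case
  proof (rule summable_comparison_test'[where N = 0])
    fix n
    have "x ^ n = z ^ n * z ^ n" by (simp add: z(3) flip: power_mult_distrib)
    then have "real (n + a) ^ Suc p * x ^ n = (real (n + a) * z ^ n) * (real (n + a) ^ p * z ^ n)"
      by simp
    also have "\<dots> \<le> K * (real (n + a) ^ p * z ^ n)"
      using K[of n] z by (intro mult_right_mono) auto
    finally show "norm (real (n + a) ^ Suc p * x ^ n) \<le> K * (real (n + a) ^ p * z ^ n)"
      using Suc.prems by simp
  qed
qed

text \<open>For \<open>r < R\<close> below the radius of the series of \<open>d\<close>, the partial sums of \<open>d\<close> are at most
  \<open>S / R ^ (n + b)\<close>, because \<open>R < 1\<close>; so \<open>c n * r ^ n\<close> is at most a polynomial times \<open>(r / R) ^ n\<close>. That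
  \<open>R < 1\<close> comes from the last assumption. Without it \<open>d = (1, 0, 0, \<dots>)\<close> and \<open>c = (1, 1, 1, \<dots>)\<close> would
  be possible, whose radii differ.\<close>

lemma conv_radius_eq_of_polynomial_comparison:
  fixes c d :: "nat \<Rightarrow> nat"
  assumes le: "\<And>n. d n \<le> c n"
    and ge: "\<And>n. c n \<le> A * (n + a) ^ p * (\<Sum>j\<le>n + b. d j)"
    and inf: "infinite {n. d n \<noteq> 0}"
  shows "conv_radius (\<lambda>n. of_nat (d n) :: complex) = conv_radius (\<lambda>n. of_nat (c n) :: complex)"
proof (rule antisym)
  show "conv_radius (\<lambda>n. of_nat (c n) :: complex) \<le> conv_radius (\<lambda>n. of_nat (d n) :: complex)"
    using le by (rule conv_radius_antimono_nat)
  show "conv_radius (\<lambda>n. of_nat (d n) :: complex) \<le> conv_radius (\<lambda>n. of_nat (c n) :: complex)"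
  proof (rule conv_radius_geI_ex)
    fix r :: real
    assume r: "r > 0" "ereal r < conv_radius (\<lambda>n. of_nat (d n) :: complex)"
    obtain R where R: "r < R" "ereal R < conv_radius (\<lambda>n. of_nat (d n) :: complex)"
      using ereal_dense2[OF r(2)] by auto
    have "ereal R < 1" using R(2) conv_radius_le_one[OF inf] by (rule less_le_trans)
    then have R1: "R < 1" by (simp add: one_ereal_def)
    have R0: "R > 0" using r R by simp
    have sumd: "summable (\<lambda>j. real (d j) * R ^ j)"
      using abs_summable_in_conv_radius[of "of_real R" "\<lambda>n. of_nat (d n) :: complex"] R R0
      by (simp add: norm_mult norm_power)
    define S where "S = suminf (\<lambda>j. real (d j) * R ^ j)"
    have bound: "real (c n) * r ^ n \<le> real A * real (n + a) ^ p * (r / R) ^ n * (S / R ^ b)" for n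
    proof -
      have "(\<Sum>j\<le>n + b. real (d j)) * R ^ (n + b) \<le> (\<Sum>j\<le>n + b. real (d j) * R ^ j)"
        unfolding sum_distrib_right
        using R0 R1 by (intro sum_mono mult_left_mono power_decreasing) auto
      also have "\<dots> \<le> S" unfolding S_def
        using sumd R0 by (intro sum_le_suminf) auto
      finally have s: "(\<Sum>j\<le>n + b. real (d j)) \<le> S / R ^ (n + b)"
        using R0 by (simp add: pos_le_divide_eq)
      have "real (c n) \<le> real A * real (n + a) ^ p * (\<Sum>j\<le>n + b. real (d j))"
        using of_nat_mono[OF ge[of n], where 'a = real] by simp
      also have "\<dots> \<le> real A * real (n + a) ^ p * (S / R ^ (n + b))"
        using s by (intro mult_left_mono) auto
      finally have "real (c n) * r ^ n \<le> real A * real (n + a) ^ p * (S / R ^ (n + b)) * r ^ n"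
        using r by (intro mult_right_mono) auto
      also have "\<dots> = real A * real (n + a) ^ p * (r / R) ^ n * (S / R ^ b)"
        by (simp add: power_add power_divide)
      finally show ?thesis .
    qed
    define x where "x = r / R"
    have x: "0 < x" "x < 1" using r R by (auto simp: x_def)
    have "summable (\<lambda>n. real A * real (n + a) ^ p * x ^ n * (S / R ^ b))"
      unfolding mult.assoc[of "real A"]
      by (intro summable_mult2 summable_mult summable_polynomial_times_geometric x)
    then have "summable (\<lambda>n. real (c n) * r ^ n)"
    proof (rule summable_comparison_test'[where N = 0])
      fix n
      have "norm (real (c n) * r ^ n) = real (c n) * r ^ n" using r by simp
      then show "norm (real (c n) * r ^ n) \<le> real A * real (n + a) ^ p * x ^ n * (S / R ^ b)"
        using bound[of n] unfolding x_def by (simp only:)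
    qed
    moreover have "norm (of_nat (c n) * (of_real r :: complex) ^ n) = real (c n) * r ^ n" for n
      using r(1) by (simp add: norm_mult norm_power)
    ultimately have "summable (\<lambda>n. norm (of_nat (c n) * (of_real r :: complex) ^ n))"
      by (simp only:)
    then have "summable (\<lambda>n. of_nat (c n) * (of_real r :: complex) ^ n)"
      by (rule summable_norm_cancel)
    moreover have "norm (of_real r :: complex) = r" using r(1) by simp
    ultimately show "\<exists>z. norm z = r \<and> summable (\<lambda>n. of_nat (c n) * (z :: complex) ^ n)"
      by blast
  qed
qed

theorem corollary4p4:
  fixes M N :: nat and G :: "('g, 'n) monoid_scheme" and Y :: "'g set"
  assumes "group G"
    and "finite_symmetric_generating_set G Y"
    and "infinite (carrier (tree_group M N))"
  shows "fps_conv_radius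
      (conjugacy_growth_series (wreath_product G (tree_group M N))
        (wreath_gens G (tree_group M N) Y (tree_genset M N))) =
    fps_conv_radius
      (growth_series (wreath_product G (tree_group M N))
        (wreath_gens G (tree_group M N) Y (tree_genset M N)))"
proof -
  have lamplighter: "tree_lamplighter G (tree_group M N) (tree_genset M N) Y"
    by (intro tree_lamplighter.intro wreath_groups.intro tree_lamplighter_axioms.intro
        assms(1,2) group_tree_group tree_like_tree_group)
  show ?thesis
    unfolding fps_conv_radius_def conjugacy_growth_series_def growth_series_def fps_nth_Abs_fps
    by (rule conv_radius_eq_of_polynomial_comparison[
          OF tree_lamplighter.card_class_sphere_le[OF lamplighter]
            tree_lamplighter.card_sphere_le[OF lamplighter assms(3)]
            tree_lamplighter.infinite_nonempty_class_spheres[OF lamplighter assms(3)]])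
qed

end
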